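(* Let $d\ge 1$ and let $\{\lambda_\varepsilon\}_{\varepsilon>0}$ be a family of Borel probability measures on $\mathbb{R}^d$ such that $\lambda_\varepsilon(\{0\})=0$ for all $\varepsilon>0$, and suppose that $\lim_{\varepsilon\downarrow 0}\lambda_\varepsilon(B_R^c)=0$ for every $R>0$. For each $\varepsilon>0$ let $\mu_\varepsilon$ be the probability measure on the unit sphere $\mathbb{S}^{d-1}$ given by $\mu_\varepsilon(E)=\lambda_\varepsilon((0,\infty)E)$ for Borel $E\subset\mathbb{S}^{d-1}$. Then there exist a sequence $\varepsilon_j$ converging to zero and a probability measure $\mu$ on $\mathbb{S}^{d-1}$ which is the weak limit of $\{\mu_{\varepsilon_j}\}$, such that for every $f\in \mathrm{BV}(\mathbb{R}^d)$ $$\lim_{j\to\infty}\int_{\mathbb{R}^d}\int_{\mathbb{R}^d}\frac{|f(x+y)-f(x)|}{|y|}\,\lambda_{\varepsilon_j}(\mathrm{d}y)\,\mathrm{d}x=\int_{\mathbb{S}^{d-1}}\int_{\mathbb{R}^d}|Df\cdot\theta|\,\mu(\mathrm{d}\theta).$$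
   Context: $B_R$ is the closed Euclidean ball of radius $R$ centred at $0$, and $B_R^c$ its complement. For $E\subset\mathbb{S}^{d-1}$, $(0,\infty)E=\{re: r>0,\ e\in E\}$. $\mathrm{BV}(\mathbb{R}^d)$ is the space of $u\in L^1(\mathbb{R}^d)$ whose distributional gradient $Du$ is an $\mathbb{R}^d$-valued Radon measure with finite total variation $|Du|(\mathbb{R}^d)=\sup\{\int u\,\mathrm{div}\,v\,\mathrm{d}x: v\in C_c^\infty(\mathbb{R}^d,\mathbb{R}^d),\ \|v\|_\infty\le 1\}<\infty$. For $\theta\in\mathbb{S}^{d-1}$, $Df\cdot\theta$ is the scalar signed measure obtained as the inner product of $Df$ with $\theta$, $|Df\cdot\theta|$ is its total variation measure, and $\int_{\mathbb{R}^d}|Df\cdot\theta|=|Df\cdot\theta|(\mathbb{R}^d)$. *)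

theory Defs
  imports "HOL-Probability.Probability"
begin

primrec Ck :: "nat \<Rightarrow> ('a::real_normed_vector \<Rightarrow> 'b::real_normed_vector) \<Rightarrow> bool" where
  "Ck 0 f \<longleftrightarrow> continuous_on UNIV f"
| "Ck (Suc k) f \<longleftrightarrow>
     (\<forall>x. f differentiable (at x)) \<and> (\<forall>h. Ck k (\<lambda>x. frechet_derivative f (at x) h))"

definition Cc_infinity :: "('a::real_normed_vector \<Rightarrow> 'b::real_normed_vector) set" where
  "Cc_infinity = {v. (\<forall>k. Ck k v) \<and> compact (closure {x. v x \<noteq> 0})}"

definition divergence :: "('a::euclidean_space \<Rightarrow> 'a) \<Rightarrow> 'a \<Rightarrow> real" where
  "divergence v x = (\<Sum>b\<in>Basis. frechet_derivative v (at x) b \<bullet> b)"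

text \<open>A Radon measure with values in a Euclidean space and with finite total variation is the same
  as a countably additive set function on the Borel sets. The values off the Borel sets play no
  role anywhere below.\<close>

definition vector_measure :: "('a::euclidean_space set \<Rightarrow> 'b::real_normed_vector) \<Rightarrow> bool" where
  "vector_measure \<nu> \<longleftrightarrow>
     (\<forall>A::nat \<Rightarrow> 'a set. range A \<subseteq> sets borel \<longrightarrow> disjoint_family A \<longrightarrow>
        (\<lambda>i. \<nu> (A i)) sums \<nu> (\<Union>i. A i))"

definition total_variation :: "('a::euclidean_space set \<Rightarrow> 'b::real_normed_vector) \<Rightarrow> 'a set \<Rightarrow> ennreal"
  where "total_variation \<nu> E =
     (SUP A\<in>{A::nat \<Rightarrow> 'a set. range A \<subseteq> sets borel \<and> disjoint_family A \<and> (\<Union>i. A i) = E}.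
        \<Sum>i. ennreal (norm (\<nu> (A i))))"

text \<open>The positive part in the Jordan decomposition of a signed measure; the negative part is the
  positive part of the negated measure. Truncation of negative values by \<^const>\<open>ennreal\<close> is
  harmless because the empty set always competes in the supremum.\<close>

definition positive_part :: "('a::euclidean_space set \<Rightarrow> real) \<Rightarrow> 'a measure" where
  "positive_part \<nu> =
     measure_of UNIV (sets borel) (\<lambda>E. SUP A\<in>{A \<in> sets borel. A \<subseteq> E}. ennreal (\<nu> A))"

definition signed_integral :: "('a::euclidean_space set \<Rightarrow> real) \<Rightarrow> ('a \<Rightarrow> real) \<Rightarrow> real" where
  "signed_integral \<nu> \<phi> =
     (\<integral>x. \<phi> x \<partial>(positive_part \<nu>)) - (\<integral>x. \<phi> x \<partial>(positive_part (\<lambda>E. - \<nu> E)))"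

definition is_distributional_gradient ::
    "('a::euclidean_space \<Rightarrow> real) \<Rightarrow> ('a set \<Rightarrow> 'a) \<Rightarrow> bool" where
  "is_distributional_gradient u \<nu> \<longleftrightarrow>
     vector_measure \<nu> \<and>
     (\<forall>v\<in>Cc_infinity.
        (\<integral>x. u x * divergence v x \<partial>lborel) =
          - (\<Sum>b\<in>Basis. signed_integral (\<lambda>E. \<nu> E \<bullet> b) (\<lambda>x. v x \<bullet> b)))"

definition gradient_variation :: "('a::euclidean_space \<Rightarrow> real) \<Rightarrow> ennreal" where
  "gradient_variation u =
     (SUP v\<in>{v \<in> Cc_infinity. \<forall>x. norm (v x) \<le> 1}. ennreal (\<integral>x. u x * divergence v x \<partial>lborel))"

definition BV :: "('a::euclidean_space \<Rightarrow> real) set" where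
  "BV = {u. integrable lborel u \<and> (\<exists>\<nu>. is_distributional_gradient u \<nu>) \<and>
            gradient_variation u < \<infinity>}"

text \<open>The gradient measure is determined on the Borel sets, so the choice only concerns the
  irrelevant values elsewhere.\<close>

definition distributional_gradient :: "('a::euclidean_space \<Rightarrow> real) \<Rightarrow> 'a set \<Rightarrow> 'a" where
  "distributional_gradient u = (SOME \<nu>. is_distributional_gradient u \<nu>)"

definition unit_sphere_borel :: "'a::euclidean_space measure" where
  "unit_sphere_borel = restrict_space borel (sphere 0 1)"

definition angular_measure :: "'a::euclidean_space measure \<Rightarrow> 'a measure" where
  "angular_measure M =
     measure_of (sphere 0 1) (sets unit_sphere_borel)
       (\<lambda>E. emeasure M {r *\<^sub>R e | r e. 0 < r \<and> e \<in> E})"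

definition weak_limit_on_sphere ::
    "(nat \<Rightarrow> 'a::euclidean_space measure) \<Rightarrow> 'a measure \<Rightarrow> bool" where
  "weak_limit_on_sphere \<mu>s \<mu> \<longleftrightarrow>
     (\<forall>g::'a \<Rightarrow> real. continuous_on (sphere 0 1) g \<longrightarrow>
        (\<lambda>j. \<integral>\<theta>. g \<theta> \<partial>(\<mu>s j)) \<longlonglongrightarrow> (\<integral>\<theta>. g \<theta> \<partial>\<mu>))"

end

theory Submission imports Defs begin

text \<open>Let \<open>N y\<close> be the \<open>L\<^sup>1\<close> distance between \<open>f\<close> and its translate by \<open>y\<close>, and \<open>g \<theta> = |Df \<cdot> \<theta>|(\<real>\<^sup>d)\<close>.
  For a test function \<open>\<phi>\<close>, the pairing of \<open>\<phi>\<close> with \<open>f(\<cdot> + t\<theta>)\<close> has \<open>t\<close>-derivative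
  \<open>\<integral> \<phi>(\<cdot> - t\<theta>) d(Df \<cdot> \<theta>)\<close>. Taking suprema over \<open>|\<phi>| \<le> 1\<close> gives \<open>N(t\<theta>) \<le> t g \<theta>\<close> and
  \<open>N(t\<theta>)/t \<longrightarrow> g \<theta>\<close> as \<open>t \<down> 0\<close>. The quotients are Lipschitz in \<open>\<theta>\<close> uniformly in \<open>t\<close>, because
  \<open>|N y - N z| \<le> N (y - z) \<le> C |y - z|\<close>, so the convergence is uniform on the sphere. By Tonelli the
  double integral is \<open>\<integral> N y / |y| d\<lambda>\<close>, which therefore differs from \<open>\<integral> g (y / |y|) d\<lambda>\<close>, the integral of
  the continuous function \<open>g\<close> against the angular measure, by a quantity tending to zero.

  The weak limit exists because the sphere is the continuous image of a compact set of reals with a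
  Borel section: the angular measures are transported to the line, where Helly's selection theorem
  applies, and the limit is pushed back.\<close>

section \<open>Smooth functions with compact support\<close>

text \<open>The gradient is only a set function, integrated through its Jordan parts, and these
  parts depend on \<open>\<theta>\<close> in a nonlinear way. Two facts make the duality usable.
  Integration is still linear in the signed measure, which ties all directions to the finitely many
  basis directions and yields one constant \<open>C\<close> for every bound and Lipschitz estimate.
  And the supremum over smooth test functions reaches the total variation, although the optimal
  function is the sign function of a Hahn set, which is merely Borel: outer regularity enlarges that
  set to an open one, whose indicator is a limit of smooth functions. Convergence in each fixed
  direction would not suffice, because the measures may concentrate on radii and directions that
  vary together; uniformity on the sphere removes this coupling. Away from the origin the error is
  at most \<open>C\<close> times a vanishing mass. The sequence and \<open>\<mu>\<close> come from
  weak compactness alone, so they are fixed before \<open>f\<close> enters.\<close>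

lemma Ck_imp_continuous: "Ck k f \<Longrightarrow> continuous_on UNIV f"
  by (cases k)
    (auto simp: continuous_on_eq_continuous_within intro: differentiable_imp_continuous_within)

lemma Ck_SucD: "Ck (Suc k) f \<Longrightarrow> Ck k f"
proof (induction k arbitrary: f)
  case 0
  then show ?case using Ck_imp_continuous[OF 0] by simp
next
  case (Suc k)
  have "f differentiable (at x)" and "Ck (Suc k) (\<lambda>x. frechet_derivative f (at x) h)" for x h
    using Suc.prems unfolding Ck.simps(2)[of "Suc k"] by blast+
  with Suc.IH show ?case unfolding Ck.simps(2)[of k] by blast
qed

lemma Ck_const: "Ck k (\<lambda>x. c)"
  by (induction k arbitrary: c) auto

lemma Ck_bounded_linear_comp:
  assumes "bounded_linear L"
  shows "Ck k f \<Longrightarrow> Ck k (\<lambda>x. L (f x))"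
proof (induction k arbitrary: f)
  case 0
  then show ?case
    by (auto intro: bounded_linear.continuous_on[OF assms])
next
  case (Suc k)
  have d: "((\<lambda>x. L (f x)) has_derivative (\<lambda>h. L (frechet_derivative f (at x) h))) (at x)" for x
    using Suc.prems by (auto intro!: bounded_linear.has_derivative[OF assms]
        simp: frechet_derivative_works[symmetric])
  then have "frechet_derivative (\<lambda>x. L (f x)) (at x) = (\<lambda>h. L (frechet_derivative f (at x) h))" for x
    by (metis frechet_derivative_at)
  moreover have "Ck k (\<lambda>x. L (frechet_derivative f (at x) h))" for h
    using Suc.prems by (intro Suc.IH) simp
  ultimately show ?case
    using d by (auto simp: differentiable_def)
qed

lemma Ck_bounded_linear:
  assumes "bounded_linear L"
  shows "Ck k L"
proof (cases k)
  case 0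
  then show ?thesis using linear_continuous_on[OF assms] by simp
next
  case (Suc n)
  have "frechet_derivative L (at x) = L" for x
    by (metis assms bounded_linear_imp_has_derivative frechet_derivative_at)
  then show ?thesis using Suc assms
    by (auto simp: Ck_const bounded_linear_imp_differentiable)
qed

lemma Ck_add: "Ck k f \<Longrightarrow> Ck k g \<Longrightarrow> Ck k (\<lambda>x. f x + g x)"
proof (induction k arbitrary: f g)
  case 0
  then show ?case by (auto intro: continuous_on_add)
next
  case (Suc k)
  have d: "((\<lambda>x. f x + g x) has_derivative
      (\<lambda>h. frechet_derivative f (at x) h + frechet_derivative g (at x) h)) (at x)" for x
    using Suc.prems by (auto intro!: has_derivative_add simp: frechet_derivative_works[symmetric])
  then have "frechet_derivative (\<lambda>x. f x + g x) (at x) =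
      (\<lambda>h. frechet_derivative f (at x) h + frechet_derivative g (at x) h)" for x
    by (metis frechet_derivative_at)
  with d Suc show ?case
    by (auto simp: differentiable_def)
qed

lemma Ck_sum: "(\<And>i. i \<in> I \<Longrightarrow> Ck k (f i)) \<Longrightarrow> Ck k (\<lambda>x. \<Sum>i\<in>I. f i x)"
  by (induction I rule: infinite_finite_induct) (auto simp: Ck_const intro: Ck_add)

lemma Ck_mult:
  fixes f g :: "'a::real_normed_vector \<Rightarrow> real"
  shows "Ck k f \<Longrightarrow> Ck k g \<Longrightarrow> Ck k (\<lambda>x. f x * g x)"
proof (induction k arbitrary: f g)
  case 0
  then show ?case by (auto intro: continuous_on_mult)
next
  case (Suc k)
  have d: "((\<lambda>x. f x * g x) has_derivative
      (\<lambda>h. f x * frechet_derivative g (at x) h + frechet_derivative f (at x) h * g x)) (at x)" for x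
    using Suc.prems by (auto intro!: has_derivative_mult simp: frechet_derivative_works[symmetric])
  then have e: "frechet_derivative (\<lambda>x. f x * g x) (at x) =
      (\<lambda>h. f x * frechet_derivative g (at x) h + frechet_derivative f (at x) h * g x)" for x
    by (metis frechet_derivative_at)
  have "Ck k (\<lambda>x. f x * frechet_derivative g (at x) h + frechet_derivative f (at x) h * g x)" for h
    using Suc Ck_SucD[of k f] Ck_SucD[of k g] by (intro Ck_add Suc.IH) auto
  with d e show ?case
    by (auto simp: differentiable_def)
qed

text \<open>The chain rule replaces \<open>G n\<close> by \<open>G (Suc n)\<close> while the order
  drops by one, so the induction needs the whole tower of derivatives and has to leave
  \<open>n\<close> arbitrary.\<close>

lemma Ck_compose_DERIV:
  fixes f :: "'a::real_normed_vector \<Rightarrow> real" and G :: "nat \<Rightarrow> real \<Rightarrow> real"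
  assumes G: "\<And>n t. (G n has_real_derivative G (Suc n) t) (at t)"
  shows "Ck k f \<Longrightarrow> Ck k (\<lambda>x. G n (f x))"
proof (induction k arbitrary: f n)
  case 0
  have "continuous_on UNIV (G n)"
    by (meson G DERIV_isCont continuous_at_imp_continuous_on)
  with 0 show ?case
    by (auto intro: continuous_on_compose2)
next
  case (Suc k)
  have d: "((\<lambda>x. G n (f x)) has_derivative
      (\<lambda>h. frechet_derivative f (at x) h * G (Suc n) (f x))) (at x)" for x
    using Suc.prems by (intro DERIV_compose_FDERIV[OF G]) (auto simp: frechet_derivative_works[symmetric])
  then have e: "frechet_derivative (\<lambda>x. G n (f x)) (at x) =
      (\<lambda>h. frechet_derivative f (at x) h * G (Suc n) (f x))" for x
    by (metis frechet_derivative_at)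
  have "Ck k (\<lambda>x. frechet_derivative f (at x) h * G (Suc n) (f x))" for h
    using Suc Ck_SucD[of k f] by (intro Ck_mult Suc.IH) auto
  with d e show ?case
    by (auto simp: differentiable_def)
qed

lemma Ck_exp:
  fixes f :: "'a::real_normed_vector \<Rightarrow> real"
  assumes "Ck k f"
  shows "Ck k (\<lambda>x. exp (f x))"
  by (rule Ck_compose_DERIV[where G = "\<lambda>n. exp" and n = 0, OF DERIV_exp assms])

lemma Ck_shift: "Ck k f \<Longrightarrow> Ck k (\<lambda>x. f (x - a))"
proof (induction k arbitrary: f)
  case 0
  then show ?case by (auto intro!: continuous_on_compose2[of UNIV f] continuous_intros)
next
  case (Suc k)
  have d: "((\<lambda>x. f (x - a)) has_derivative frechet_derivative f (at (x - a))) (at x)" for x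
  proof -
    have "((\<lambda>x. x - a) has_derivative (\<lambda>h. h)) (at x)"
      by (auto intro!: derivative_eq_intros)
    moreover have "(f has_derivative frechet_derivative f (at (x - a))) (at (x - a))"
      using Suc.prems by (auto simp: frechet_derivative_works[symmetric])
    ultimately show ?thesis
      by (rule has_derivative_compose)
  qed
  then have "frechet_derivative (\<lambda>x. f (x - a)) (at x) = frechet_derivative f (at (x - a))" for x
    by (metis frechet_derivative_at)
  moreover have "Ck k (\<lambda>x. frechet_derivative f (at (x - a)) h)" for h
    using Suc.prems by (intro Suc.IH[of "\<lambda>x. frechet_derivative f (at x) h"]) simp
  ultimately show ?case
    using d by (auto simp: differentiable_def)
qed

lemma Cc_infinityI:
  assumes "\<And>k. Ck k v" "compact K" "\<And>x. x \<notin> K \<Longrightarrow> v x = 0"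
  shows "v \<in> Cc_infinity"
proof -
  have "closure {x. v x \<noteq> 0} \<subseteq> K"
    using assms by (intro closure_minimal) (auto simp: compact_imp_closed)
  then have "compact (closure {x. v x \<noteq> 0})"
    using compact_Int_closed[OF assms(2) closed_closure, of "{x. v x \<noteq> 0}"] by (simp add: Int_absorb1)
  with assms show ?thesis by (auto simp: Cc_infinity_def)
qed

lemma Cc_infinityE:
  assumes "v \<in> Cc_infinity"
  obtains K where "\<And>k. Ck k v" "compact K" "\<And>x. x \<notin> K \<Longrightarrow> v x = 0"
proof
  show "\<And>k. Ck k v" "compact (closure {x. v x \<noteq> 0})"
    using assms by (auto simp: Cc_infinity_def)
  show "v x = 0" if "x \<notin> closure {x. v x \<noteq> 0}" for x
    using that closure_subset[of "{x. v x \<noteq> 0}"] by auto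
qed

lemma Cc_infinity_shift:
  assumes "v \<in> Cc_infinity"
  shows "(\<lambda>x. v (x - a)) \<in> Cc_infinity"
proof -
  from assms obtain K where K: "\<And>k. Ck k v" "compact K" "\<And>x. x \<notin> K \<Longrightarrow> v x = 0"
    by (rule Cc_infinityE) blast
  show ?thesis
  proof (rule Cc_infinityI)
    show "compact ((+) a ` K)"
      using K(2) by (rule compact_translation)
    show "v (x - a) = 0" if "x \<notin> (+) a ` K" for x
    proof (rule K(3))
      show "x - a \<notin> K"
        using that by (metis add.commute diff_add_cancel image_eqI)
    qed
    show "Ck k (\<lambda>x. v (x - a))" for k
      using K(1) by (rule Ck_shift)
  qed
qed

section \<open>Flat functions, bumps and smooth approximation of open sets\<close>

lemma poly_times_exp_minus_tendsto_0:
  fixes p :: "real poly"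
  shows "((\<lambda>s. poly p s * exp (- s)) \<longlongrightarrow> 0) at_top"
proof -
  have "((\<lambda>s. \<Sum>i\<le>degree p. coeff p i * (s ^ i / exp s)) \<longlongrightarrow> (\<Sum>i\<le>degree p. coeff p i * 0)) at_top"
    by (intro tendsto_intros tendsto_power_div_exp_0)
  moreover have "(\<Sum>i\<le>degree p. coeff p i * (s ^ i / exp s)) = poly p s * exp (- s)" for s
    by (simp add: poly_altdef sum_distrib_right exp_minus divide_inverse mult.assoc)
  ultimately show ?thesis by simp
qed

text \<open>The shape of every derivative of \<open>exp (- 1/t)\<close>.\<close>

definition exp_flat :: "real poly \<Rightarrow> real \<Rightarrow> real" where
  "exp_flat p t = (if t > 0 then poly p (1 / t) * exp (- (1 / t)) else 0)"

text \<open>With s = 1/t, the t-derivative of p(s) exp(-s) is s^2 (p(s) - p'(s)) exp(-s); this is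
  where the factor \<open>[:0, 0, 1:]\<close> comes from, and it closes the class under
  differentiation. At 0 the right difference quotient is s p(s) exp(-s), and exponential decay beats
  every polynomial.\<close>

lemma exp_flat_DERIV:
  "(exp_flat p has_real_derivative exp_flat ([:0, 0, 1:] * (p - pderiv p)) t) (at t)"
proof (cases t "0::real" rule: linorder_cases)
  case less
  have "((\<lambda>_. 0) has_real_derivative 0) (at t)" by simp
  then have "(exp_flat p has_real_derivative 0) (at t)"
    by (rule has_field_derivative_transform_within_open[of _ _ _ "{..<0}"])
      (use less in \<open>auto simp: exp_flat_def\<close>)
  then show ?thesis using less by (simp add: exp_flat_def)
next
  case greater
  have "((\<lambda>t. poly p (1 / t) * exp (- (1 / t))) has_real_derivative
      exp_flat ([:0, 0, 1:] * (p - pderiv p)) t) (at t)"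
    using greater
    by (auto intro!: derivative_eq_intros DERIV_chain2[OF poly_DERIV]
        simp: exp_flat_def field_simps power2_eq_square)
  then show ?thesis
    by (rule has_field_derivative_transform_within_open[of _ _ _ "{0<..}"])
      (use greater in \<open>auto simp: exp_flat_def\<close>)
next
  case equal
  have "((\<lambda>h. exp_flat p h / h) \<longlongrightarrow> 0) (at_right 0)"
  proof -
    have "((\<lambda>h. poly ([:0,1:] * p) (inverse h) * exp (- inverse h)) \<longlongrightarrow> 0) (at_right 0)"
      by (rule filterlim_compose[OF poly_times_exp_minus_tendsto_0 filterlim_inverse_at_top_right])
    moreover have "\<forall>\<^sub>F h in at_right 0. poly ([:0,1:] * p) (inverse h) * exp (- inverse h) = exp_flat p h / h"
      using eventually_at_right_less by eventually_elim (auto simp: exp_flat_def field_simps)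
    ultimately show ?thesis by (rule Lim_transform_eventually)
  qed
  moreover have "((\<lambda>h. exp_flat p h / h) \<longlongrightarrow> 0) (at_left 0)"
    by (rule tendsto_eventually) (auto simp: eventually_at_filter exp_flat_def)
  ultimately have "((\<lambda>h. exp_flat p h / h) \<longlongrightarrow> 0) (at 0)"
    by (simp add: filterlim_split_at)
  then show ?thesis
    using equal by (simp add: DERIV_def exp_flat_def)
qed

lemma Ck_exp_flat:
  fixes f :: "'a::real_normed_vector \<Rightarrow> real"
  assumes "Ck k f"
  shows "Ck k (\<lambda>x. exp_flat p (f x))"
proof -
  define G where "G n = exp_flat (((\<lambda>p. [:0, 0, 1:] * (p - pderiv p)) ^^ n) p)" for n
  have "(G n has_real_derivative G (Suc n) t) (at t)" for n t
    using exp_flat_DERIV by (auto simp: G_def)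
  from Ck_compose_DERIV[where G = G and n = 0, OF this assms] show ?thesis by (simp add: G_def)
qed

text \<open>The squared distance is spelled out in coordinates so that smoothness follows from
  closure under sums and products; \<open>bump_eq\<close> recovers the radial form.\<close>

definition bump :: "'a::euclidean_space \<Rightarrow> real \<Rightarrow> 'a \<Rightarrow> real" where
  "bump c r x = exp_flat 1 (r\<^sup>2 - (\<Sum>b\<in>Basis. ((x - c) \<bullet> b) * ((x - c) \<bullet> b)))"

lemma bump_eq: "bump c r x = exp_flat 1 (r\<^sup>2 - (dist c x)\<^sup>2)"
proof -
  have "(\<Sum>b\<in>Basis. ((x - c) \<bullet> b) * ((x - c) \<bullet> b)) = (dist c x)\<^sup>2"
    by (subst dist_commute) (simp add: euclidean_inner[symmetric] dist_norm power2_norm_eq_inner)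
  then show ?thesis by (simp add: bump_def)
qed

lemma bump_nonneg: "bump c r x \<ge> 0"
  by (simp add: bump_eq exp_flat_def)

lemma bump_pos_iff: "r > 0 \<Longrightarrow> bump c r x > 0 \<longleftrightarrow> x \<in> ball c r"
  using power_mono_iff[of r "dist c x" 2] by (simp add: bump_eq exp_flat_def not_le[symmetric])

lemma Ck_bump: "Ck k (bump c r)"
proof -
  have *: "Ck k (\<lambda>x. (x - c) \<bullet> b)" for b
    by (rule Ck_bounded_linear_comp[OF bounded_linear_inner_left
          Ck_shift[OF Ck_bounded_linear[OF bounded_linear_ident]]])
  have "Ck k (\<lambda>x. r\<^sup>2 + (\<Sum>b\<in>Basis. (- 1) * (((x - c) \<bullet> b) * ((x - c) \<bullet> b))))"
    by (intro Ck_add Ck_sum Ck_mult Ck_const *)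
  then have "Ck k (\<lambda>x. r\<^sup>2 - (\<Sum>b\<in>Basis. ((x - c) \<bullet> b) * ((x - c) \<bullet> b)))"
    by (simp add: sum_negf)
  from Ck_exp_flat[OF this] show ?thesis
    by (simp add: bump_def[abs_def])
qed

text \<open>By Lindelof, \<open>U\<close> is a countable union of balls. A finite sum of their bumps
  is positive exactly on the finite union of these balls, and 1 - exp(-n s) pushes positive values s
  towards 1 while it keeps the zeros. Each stage uses finitely many bumps, so its support is
  compact.\<close>

lemma smooth_approx_open:
  fixes U :: "'a::euclidean_space set"
  assumes "open U"
  obtains \<phi> :: "nat \<Rightarrow> 'a \<Rightarrow> real" where "\<And>n. \<phi> n \<in> Cc_infinity" "\<And>n x. 0 \<le> \<phi> n x" "\<And>n x. \<phi> n x \<le> 1"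
    "\<And>x. (\<lambda>n. \<phi> n x) \<longlonglongrightarrow> indicator U x"
proof (cases "U = {}")
  case True
  show ?thesis
  proof (rule that[of "\<lambda>n x. 0"])
    show "(\<lambda>x::'a. 0::real) \<in> Cc_infinity"
      by (rule Cc_infinityI[of _ "{}"]) (auto simp: Ck_const)
  qed (use True in auto)
next
  case False
  define \<F> where "\<F> = {ball c r |c r. r > 0 \<and> ball c r \<subseteq> U}"
  have Un: "\<Union>\<F> = U"
    unfolding \<F>_def using \<open>open U\<close> by (auto simp: open_contains_ball) (metis centre_in_ball)
  obtain \<F>' where F': "\<F>' \<subseteq> \<F>" "countable \<F>'" "\<Union>\<F>' = \<Union>\<F>"
    by (rule Lindelof[of \<F>]) (auto simp: \<F>_def)
  have "\<F>' \<noteq> {}" using F' Un False by auto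
  then have rng: "range (from_nat_into \<F>') = \<F>'"
    using F' by (simp add: range_from_nat_into)
  have "\<forall>i. \<exists>c r. r > 0 \<and> from_nat_into \<F>' i = ball c r"
  proof
    fix i
    have "from_nat_into \<F>' i \<in> \<F>"
      using rng F'(1) by auto
    then show "\<exists>c r. r > 0 \<and> from_nat_into \<F>' i = ball c r"
      unfolding \<F>_def by blast
  qed
  then obtain c r where cr: "\<And>i::nat. r i > (0::real)" "\<And>i. from_nat_into \<F>' i = ball (c i) (r i)"
    by metis
  have U: "U = (\<Union>i. ball (c i) (r i))"
  proof -
    have "U = \<Union>(range (from_nat_into \<F>'))" using rng F' Un by simp
    then show ?thesis by (simp add: cr(2))
  qed
  define S where "S n x = (\<Sum>i<n. bump (c i) (r i) x)" for n x
  \<comment> \<open>The index \<open>n\<close> both counts the bumps and amplifies their sum. On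
    \<open>U\<close> the sums eventually dominate one fixed positive bump, so
    \<open>real n * S n x\<close> diverges.\<close>
  define \<phi> where "\<phi> n x = 1 - exp (- (real n * S n x))" for n x
  have S0: "S n x \<ge> 0" for n x by (auto simp: S_def intro: sum_nonneg bump_nonneg)
  have bz: "bump (c i) (r i) x = 0" if "x \<notin> ball (c i) (r i)" for i x
    using that bump_pos_iff[OF cr(1), of "c i" i x] bump_nonneg[of "c i" "r i" x] by linarith
  show ?thesis
  proof (rule that)
    show "\<phi> n \<in> Cc_infinity" for n
    proof (rule Cc_infinityI)
      have "Ck k (\<lambda>x. 1 + (- 1) * exp ((- real n) * S n x))" for k
        unfolding S_def by (intro Ck_add Ck_const Ck_mult Ck_exp Ck_sum Ck_bump)
      then show "Ck k (\<phi> n)" for k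
        by (simp add: \<phi>_def[abs_def])
      show "compact (\<Union>i<n. cball (c i) (r i))"
        by (intro compact_UN) auto
      show "\<phi> n x = 0" if "x \<notin> (\<Union>i<n. cball (c i) (r i))" for x
      proof -
        have "S n x = 0" unfolding S_def using that by (intro sum.neutral) (force intro!: bz)
        then show ?thesis by (simp add: \<phi>_def)
      qed
    qed
    show "0 \<le> \<phi> n x" for n x using S0 by (simp add: \<phi>_def)
    show "\<phi> n x \<le> 1" for n x by (simp add: \<phi>_def)
    show "(\<lambda>n. \<phi> n x) \<longlonglongrightarrow> indicator U x" for x
    proof (cases "x \<in> U")
      case True
      then obtain i where i: "x \<in> ball (c i) (r i)" using U by auto
      define \<beta> where "\<beta> = bump (c i) (r i) x"
      have "\<beta> > 0" using i by (simp add: \<beta>_def bump_pos_iff cr)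
      have "S n x \<ge> \<beta>" if "n > i" for n
        unfolding S_def \<beta>_def using that by (intro member_le_sum) (auto intro: bump_nonneg)
      then have "\<beta> * real n \<le> real n * S n x" if "n > i" for n
        using that by (simp add: mult.commute[of \<beta>] mult_left_mono)
      then have "\<forall>\<^sub>F n in sequentially. \<beta> * real n \<le> real n * S n x"
        using eventually_gt_at_top[of i] by (rule eventually_mono[rotated])
      moreover have "filterlim (\<lambda>n. \<beta> * real n) at_top sequentially"
        using \<open>\<beta> > 0\<close> by (intro filterlim_tendsto_pos_mult_at_top[OF tendsto_const] filterlim_real_sequentially)
      ultimately have "filterlim (\<lambda>n. real n * S n x) at_top sequentially"
        by (rule filterlim_at_top_mono[rotated])
      then have "filterlim (\<lambda>n. - (real n * S n x)) at_bot sequentially"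
        by (simp add: filterlim_uminus_at_top)
      then have "(\<lambda>n. exp (- (real n * S n x))) \<longlonglongrightarrow> 0"
        by (rule filterlim_compose[OF exp_at_bot])
      then have "(\<lambda>n. \<phi> n x) \<longlonglongrightarrow> 1 - 0"
        unfolding \<phi>_def by (intro tendsto_intros)
      then show ?thesis using True by simp
    next
      case False
      then have "S n x = 0" for n
        unfolding S_def using U by (intro sum.neutral) (auto intro!: bz)
      then show ?thesis using False by (simp add: \<phi>_def)
    qed
  qed
qed

text \<open>The limit is -1 off \<open>U\<close>, so rescaling the approximations of the indicator
  destroys compact support. Multiplying by cutoffs \<open>\<kappa> n\<close>, which are the
  approximations for \<open>U = UNIV\<close>, restores it.\<close>

lemma smooth_approx_sign_open:
  fixes U :: "'a::euclidean_space set"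
  assumes "open U"
  obtains \<phi> :: "nat \<Rightarrow> 'a \<Rightarrow> real" where "\<And>n. \<phi> n \<in> Cc_infinity" "\<And>n x. \<bar>\<phi> n x\<bar> \<le> 1"
    "\<And>x. (\<lambda>n. \<phi> n x) \<longlonglongrightarrow> 2 * indicator U x - 1"
proof -
  obtain \<phi> :: "nat \<Rightarrow> 'a \<Rightarrow> real" where \<phi>: "\<And>n. \<phi> n \<in> Cc_infinity" "\<And>n x. 0 \<le> \<phi> n x"
    "\<And>n x. \<phi> n x \<le> 1" "\<And>x. (\<lambda>n. \<phi> n x) \<longlonglongrightarrow> indicator U x"
    using smooth_approx_open[OF assms] by metis
  obtain \<kappa> :: "nat \<Rightarrow> 'a \<Rightarrow> real" where \<kappa>: "\<And>n. \<kappa> n \<in> Cc_infinity" "\<And>n x. 0 \<le> \<kappa> n x"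
    "\<And>n x. \<kappa> n x \<le> 1" "\<And>x. (\<lambda>n. \<kappa> n x) \<longlonglongrightarrow> indicator UNIV x"
    using smooth_approx_open[OF open_UNIV] by metis
  show ?thesis
  proof (rule that)
    show "(\<lambda>x. \<kappa> n x * (2 * \<phi> n x + - 1)) \<in> Cc_infinity" for n
    proof -
      from \<kappa>(1)[of n] obtain K where K: "\<And>k. Ck k (\<kappa> n)" "compact K" "\<And>x. x \<notin> K \<Longrightarrow> \<kappa> n x = 0"
        by (rule Cc_infinityE) blast
      have "Ck k (\<phi> n)" for k using \<phi>(1)[of n] by (auto simp: Cc_infinity_def)
      with K show ?thesis
        by (intro Cc_infinityI[OF _ K(2)] Ck_mult Ck_add Ck_const) auto
    qed
    show "\<bar>\<kappa> n x * (2 * \<phi> n x + - 1)\<bar> \<le> 1" for n x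
    proof -
      have "\<bar>\<kappa> n x\<bar> * \<bar>2 * \<phi> n x + - 1\<bar> \<le> 1 * 1"
        using \<phi>(2,3)[of n x] \<kappa>(2,3)[of n x] by (intro mult_mono) auto
      then show ?thesis by (simp add: abs_mult)
    qed
    show "(\<lambda>n. \<kappa> n x * (2 * \<phi> n x + - 1)) \<longlonglongrightarrow> 2 * indicator U x - 1" for x
      using \<kappa>(4)[of x] by (auto intro!: tendsto_eq_intros \<phi>(4)[of x] \<kappa>(4)[of x])
  qed
qed

section \<open>Signed measures\<close>

lemma vector_measureD:
  assumes "vector_measure \<sigma>" "\<And>i::nat. A i \<in> sets borel" "disjoint_family A"
  shows "(\<lambda>i. \<sigma> (A i)) sums \<sigma> (\<Union>i. A i)"
  using assms unfolding vector_measure_def by blast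

text \<open>The constant family \<open>{}\<close> is disjoint, and a constant series converges only
  if its terms vanish.\<close>

lemma vector_measure_empty:
  assumes "vector_measure \<sigma>"
  shows "\<sigma> {} = 0"
proof -
  have "(\<lambda>i::nat. \<sigma> {}) sums \<sigma> {}"
    using vector_measureD[OF assms, of "\<lambda>i. {}"] by (auto simp: disjoint_family_on_def)
  then have "(\<lambda>i::nat. \<sigma> {}) \<longlonglongrightarrow> 0"
    by (intro summable_LIMSEQ_zero sums_summable)
  then show ?thesis by (simp add: LIMSEQ_const_iff)
qed

lemma vector_measure_Un:
  assumes "vector_measure \<sigma>" "A \<in> sets borel" "B \<in> sets borel" "A \<inter> B = {}"
  shows "\<sigma> (A \<union> B) = \<sigma> A + \<sigma> B"
proof -
  have "(\<lambda>i. \<sigma> (binaryset A B i)) sums \<sigma> (\<Union>i. binaryset A B i)"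
    using assms by (intro vector_measureD[OF assms(1)])
      (auto simp: binaryset_def disjoint_family_on_def)
  moreover have "(\<lambda>i. \<sigma> (binaryset A B i)) sums (\<sigma> A + \<sigma> B)"
    by (rule binaryset_sums) (rule vector_measure_empty[OF assms(1)])
  ultimately show ?thesis
    by (simp add: UN_binaryset_eq sums_unique2)
qed

lemma vector_measure_split:
  assumes "vector_measure \<sigma>" "A \<in> sets borel" "B \<in> sets borel"
  shows "\<sigma> A = \<sigma> (A \<inter> B) + \<sigma> (A - B)"
proof -
  have "(A \<inter> B) \<inter> (A - B) = {}" by auto
  then show ?thesis
    using vector_measure_Un[OF assms(1), of "A \<inter> B" "A - B"] assms(2,3) by (simp add: Int_Diff_Un)
qed

lemma vector_measure_bounded_linear:
  assumes "vector_measure \<nu>" "bounded_linear L"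
  shows "vector_measure (\<lambda>E. L (\<nu> E))"
  using assms bounded_linear.sums unfolding vector_measure_def by blast

lemma vector_measure_uminus:
  "vector_measure \<sigma> \<Longrightarrow> vector_measure (\<lambda>E. - \<sigma> E)"
  by (rule vector_measure_bounded_linear[OF _ bounded_linear_minus[OF bounded_linear_ident]])

lemma vector_measure_inner:
  "vector_measure \<nu> \<Longrightarrow> vector_measure (\<lambda>E. \<nu> E \<bullet> \<theta>)"
  by (rule vector_measure_bounded_linear[OF _ bounded_linear_inner_left])

section \<open>Hahn decomposition\<close>

definition positive_set :: "('a::euclidean_space set \<Rightarrow> real) \<Rightarrow> 'a set \<Rightarrow> bool" where
  "positive_set \<sigma> P \<longleftrightarrow> P \<in> sets borel \<and> (\<forall>A\<in>sets borel. A \<subseteq> P \<longrightarrow> 0 \<le> \<sigma> A)"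

lemma positive_set_UN:
  fixes P :: "nat \<Rightarrow> 'a::euclidean_space set"
  assumes \<sigma>: "vector_measure \<sigma>" and P: "\<And>i. positive_set \<sigma> (P i)"
  shows "positive_set \<sigma> (\<Union>i. P i)"
  unfolding positive_set_def
proof (intro conjI ballI impI)
  have P': "P i \<in> sets borel" for i using P by (auto simp: positive_set_def)
  then show "(\<Union>i. P i) \<in> sets borel" by auto
  fix A assume A: "A \<in> sets borel" "A \<subseteq> (\<Union>i. P i)"
  have d: "disjointed P i \<in> sets borel" for i
    using sets.range_disjointed_sets[of P borel] P' by auto
  have s: "(\<lambda>i. \<sigma> (A \<inter> disjointed P i)) sums \<sigma> (\<Union>i. A \<inter> disjointed P i)"
    using A d disjoint_family_disjointed[of P]
    by (intro vector_measureD[OF \<sigma>]) (simp_all add: disjoint_family_on_def, blast)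
  have "0 \<le> \<sigma> (A \<inter> disjointed P i)" for i
  proof -
    have "A \<inter> disjointed P i \<in> sets borel" "A \<inter> disjointed P i \<subseteq> P i"
      using A d[of i] disjointed_subset[of P i] by auto
    with P[of i] show ?thesis by (simp add: positive_set_def)
  qed
  then have "0 \<le> \<sigma> (\<Union>i. A \<inter> disjointed P i)"
    by (rule sums_le[OF _ sums_zero s])
  moreover have "(\<Union>i. A \<inter> disjointed P i) = A"
    using A UN_disjointed_eq[of P] by auto
  ultimately show "0 \<le> \<sigma> A" by simp
qed

text \<open>Greedy removal: at each stage a set of nonpositive measure is cut out whose negativity
  is comparable to the worst one still available. The removed values form a convergent series, hence
  tend to 0, and nothing negative can survive in what is left. Removing nonpositive values does not
  lower the total.\<close>

lemma positive_subset_exists: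
  fixes \<sigma> :: "'a::euclidean_space set \<Rightarrow> real"
  assumes \<sigma>: "vector_measure \<sigma>" and A0: "A0 \<in> sets borel"
  obtains B where "B \<subseteq> A0" "positive_set \<sigma> B" "\<sigma> A0 \<le> \<sigma> B"
proof -
  \<comment> \<open>The cap 1 covers the case that the values \<open>- \<sigma> D\<close> are
    unbounded, which is not excluded at this stage. The factor 1/2 is there because a supremum need
    not be attained, whereas half of a positive one is exceeded.\<close>
  have step: "\<exists>C\<in>sets borel. C \<subseteq> A \<and> \<sigma> C \<le> 0 \<and>
      (\<forall>D\<in>sets borel. D \<subseteq> A \<longrightarrow> min 1 (- \<sigma> D / 2) \<le> - \<sigma> C)" for A
  proof (cases "\<exists>D\<in>sets borel. D \<subseteq> A \<and> - \<sigma> D \<ge> 1")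
    case True
    then obtain D where "D \<in> sets borel" "D \<subseteq> A" "- \<sigma> D \<ge> 1" by blast
    then show ?thesis by (intro bexI[of _ D]) (auto simp: min_le_iff_disj)
  next
    case False
    define V where "V = {- \<sigma> D |D. D \<in> sets borel \<and> D \<subseteq> A}"
    have bdd: "bdd_above V" unfolding bdd_above_def
      using False by (intro exI[of _ 1]) (auto simp: V_def)
    have "0 \<in> V" unfolding V_def
      using vector_measure_empty[OF \<sigma>] by (auto intro!: exI[of _ "{}"])
    show ?thesis
    proof (cases "Sup V > 0")
      case True
      then obtain v where "v \<in> V" "v > Sup V / 2"
        using less_cSup_iff[of V "Sup V / 2"] bdd \<open>0 \<in> V\<close> by auto
      then obtain C where C: "C \<in> sets borel" "C \<subseteq> A" "- \<sigma> C > Sup V / 2"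
        by (auto simp: V_def)
      have "min 1 (- \<sigma> D / 2) \<le> - \<sigma> C" if "D \<in> sets borel" "D \<subseteq> A" for D
      proof -
        have "- \<sigma> D \<le> Sup V"
          using that bdd by (intro cSup_upper) (auto simp: V_def)
        then show ?thesis using C by linarith
      qed
      then show ?thesis using C True by (intro bexI[of _ C]) auto
    next
      case False
      have "- \<sigma> D \<le> 0" if "D \<in> sets borel" "D \<subseteq> A" for D
      proof -
        have "- \<sigma> D \<le> Sup V"
          using that bdd by (intro cSup_upper) (auto simp: V_def)
        then show ?thesis using False by linarith
      qed
      then show ?thesis
        using vector_measure_empty[OF \<sigma>] by (intro bexI[of _ "{}"]) (auto simp: min_le_iff_disj)
    qed
  qed
  then obtain C where C: "\<And>A. C A \<in> sets borel" "\<And>A. C A \<subseteq> A" "\<And>A. \<sigma> (C A) \<le> 0"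
      "\<And>A D. D \<in> sets borel \<Longrightarrow> D \<subseteq> A \<Longrightarrow> min 1 (- \<sigma> D / 2) \<le> - \<sigma> (C A)"
    by metis
  define A where "A n = ((\<lambda>A. A - C A) ^^ n) A0" for n
  define D where "D n = C (A n)" for n
  have Dm: "D n \<in> sets borel" for n by (simp add: D_def C)
  have Asuc: "A (Suc n) = A n - D n" for n by (simp add: A_def D_def)
  have A_eq: "A n = A0 - (\<Union>i<n. D i)" for n
  proof (induction n)
    case 0
    show ?case by (simp add: A_def)
  qed (auto simp: Asuc lessThan_Suc)
  have DA: "D n \<subseteq> A n" for n by (simp add: D_def C)
  have disj: "disjoint_family D"
    unfolding disjoint_family_on_def
  proof (intro ballI impI)
    fix m n :: nat assume "m \<noteq> n"
    then show "D m \<inter> D n = {}"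
      using DA[of m] DA[of n] A_eq[of m] A_eq[of n] by (cases "m < n") auto
  qed
  define B where "B = A0 - (\<Union>i. D i)"
  have Bm: "B \<in> sets borel" using A0 Dm by (auto simp: B_def)
  have sums: "(\<lambda>i. \<sigma> (D i)) sums \<sigma> (\<Union>i. D i)"
    by (rule vector_measureD[OF \<sigma> Dm disj])
  have "\<sigma> (\<Union>i. D i) \<le> 0"
    by (rule sums_le[OF _ sums sums_zero]) (simp add: D_def C)
  moreover have "\<sigma> A0 = \<sigma> (\<Union>i. D i) + \<sigma> B"
  proof -
    have "(\<Union>i. D i) \<subseteq> A0" using DA A_eq by blast
    then show ?thesis
      using vector_measure_split[OF \<sigma> A0, of "\<Union>i. D i"] Dm by (simp add: B_def Int_absorb1)
  qed
  ultimately have "\<sigma> A0 \<le> \<sigma> B" by simp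
  moreover have "positive_set \<sigma> B"
    unfolding positive_set_def
  proof (intro conjI ballI impI Bm)
    fix E assume E: "E \<in> sets borel" "E \<subseteq> B"
    \<comment> \<open>A subset of \<open>B\<close> lies in every \<open>A n\<close>, so it competed
      at each stage.\<close>
    have "min 1 (- \<sigma> E / 2) \<le> - \<sigma> (D n)" for n
      unfolding D_def using E by (intro C) (auto simp: A_eq B_def)
    moreover have "(\<lambda>n. - \<sigma> (D n)) \<longlonglongrightarrow> - 0"
      by (intro tendsto_minus summable_LIMSEQ_zero sums_summable[OF sums])
    ultimately have "min 1 (- \<sigma> E / 2) \<le> - 0"
      by (intro LIMSEQ_le_const[of "\<lambda>n. - \<sigma> (D n)"]) auto
    then show "0 \<le> \<sigma> E" by (auto simp: min_def split: if_splits)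
  qed
  ultimately show ?thesis by (intro that[of B]) (auto simp: B_def)
qed

text \<open>\<open>H\<close> is the union of a maximizing sequence of positive sets. A set disjoint
  from \<open>H\<close> with positive measure would contain a positive set of at least that measure,
  and adding it to \<open>H\<close> would exceed the maximum.\<close>

lemma Hahn_decomposition:
  fixes \<sigma> :: "'a::euclidean_space set \<Rightarrow> real"
  assumes \<sigma>: "vector_measure \<sigma>"
  obtains H where "H \<in> sets borel" "\<And>A. A \<in> sets borel \<Longrightarrow> A \<subseteq> H \<Longrightarrow> 0 \<le> \<sigma> A"
    "\<And>A. A \<in> sets borel \<Longrightarrow> A \<inter> H = {} \<Longrightarrow> \<sigma> A \<le> 0"
proof -
  define V where "V = \<sigma> ` {P. positive_set \<sigma> P}"
  have pos_empty: "positive_set \<sigma> {}"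
    by (auto simp: positive_set_def vector_measure_empty[OF \<sigma>])
  have UN_ge: "\<sigma> (P i) \<le> \<sigma> (\<Union>i. P i)" if "\<And>i::nat. positive_set \<sigma> (P i)" for P i
  proof -
    have pU: "positive_set \<sigma> (\<Union>i. P i)"
      by (rule positive_set_UN[OF \<sigma> that])
    then have "0 \<le> \<sigma> ((\<Union>i. P i) - P i)"
      using that[of i] by (auto simp: positive_set_def)
    moreover have "(\<Union>i. P i) \<inter> P i = P i" by auto
    ultimately show ?thesis
      using vector_measure_split[OF \<sigma>, of "\<Union>i. P i" "P i"] pU that[of i]
      by (auto simp: positive_set_def)
  qed
  \<comment> \<open>Boundedness comes from \<open>\<sigma>\<close> being real-valued: the union of
    positive sets with arbitrarily large values would have a finite value above all of them.\<close>
  have bdd: "bdd_above V"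
  proof (rule ccontr)
    assume "\<not> bdd_above V"
    then have "\<forall>n::nat. \<exists>P. positive_set \<sigma> P \<and> real n < \<sigma> P"
      unfolding bdd_above_def V_def by (auto simp: not_le)
    then obtain P where P: "\<And>n::nat. positive_set \<sigma> (P n)" "\<And>n. real n < \<sigma> (P n)" by metis
    obtain n where "\<sigma> (\<Union>i. P i) < real n" using reals_Archimedean2 by blast
    then show False using UN_ge[of P n, OF P(1)] P(2)[of n] by linarith
  qed
  have ne: "V \<noteq> {}" using pos_empty by (auto simp: V_def)
  have "\<exists>P. positive_set \<sigma> P \<and> Sup V - 1 / real (Suc n) < \<sigma> P" for n
    using less_cSup_iff[OF ne bdd, of "Sup V - 1 / real (Suc n)"] by (auto simp: V_def)
  then obtain P where P: "\<And>n::nat. positive_set \<sigma> (P n)" "\<And>n. Sup V - 1 / real (Suc n) < \<sigma> (P n)"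
    by metis
  define H where "H = (\<Union>i. P i)"
  have H: "positive_set \<sigma> H"
    unfolding H_def by (rule positive_set_UN[OF \<sigma> P(1)])
  have "Sup V \<le> \<sigma> H"
  proof (rule field_le_epsilon)
    fix e :: real assume "e > 0"
    then obtain n where "1 / real (Suc n) < e" using nat_approx_posE by blast
    then show "Sup V \<le> \<sigma> H + e"
      using UN_ge[of P n, OF P(1)] P(2)[of n] unfolding H_def by linarith
  qed
  have max: "\<sigma> Q \<le> \<sigma> H" if "positive_set \<sigma> Q" for Q
  proof -
    have "\<sigma> Q \<le> Sup V" using that bdd by (intro cSup_upper) (auto simp: V_def)
    with \<open>Sup V \<le> \<sigma> H\<close> show ?thesis by linarith
  qed
  have "\<sigma> A \<le> 0" if A: "A \<in> sets borel" "A \<inter> H = {}" for A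
  proof -
    obtain B where B: "B \<subseteq> A" "positive_set \<sigma> B" "\<sigma> A \<le> \<sigma> B"
      using positive_subset_exists[OF \<sigma> A(1)] by blast
    have "positive_set \<sigma> (\<Union>i::nat. if i = 0 then H else B)"
      using H B by (intro positive_set_UN[OF \<sigma>]) auto
    moreover have "(\<Union>i::nat. if i = 0 then H else B) = H \<union> B"
      by (auto split: if_splits)
    ultimately have "\<sigma> (H \<union> B) \<le> \<sigma> H" using max by simp
    moreover have "\<sigma> (H \<union> B) = \<sigma> H + \<sigma> B"
      using H B A by (intro vector_measure_Un[OF \<sigma>]) (auto simp: positive_set_def)
    ultimately show ?thesis using B by linarith
  qed
  with H show ?thesis by (intro that[of H]) (auto simp: positive_set_def)
qed

section \<open>Jordan decomposition and total variation\<close>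

lemma sets_positive_part [simp, measurable_cong]: "sets (positive_part \<sigma>) = sets borel"
  using sets.sigma_algebra_axioms[of borel] unfolding positive_part_def
  by (simp add: sets.sigma_sets_eq[of borel, simplified])

lemma space_positive_part [simp]: "space (positive_part \<sigma>) = UNIV"
  by (simp add: positive_part_def)

text \<open>The supremum over subsets of \<open>E\<close> is attained at
  \<open>E \<inter> H\<close>: points outside \<open>H\<close> can only lower the value, and so can
  leaving out a part of \<open>E \<inter> H\<close>. The closed formula also yields countable
  additivity, without which \<open>measure_of\<close> would return the zero measure.\<close>

lemma emeasure_positive_part:
  fixes \<sigma> :: "'a::euclidean_space set \<Rightarrow> real"
  assumes \<sigma>: "vector_measure \<sigma>" and H: "H \<in> sets borel"
    and pos: "\<And>A. A \<in> sets borel \<Longrightarrow> A \<subseteq> H \<Longrightarrow> 0 \<le> \<sigma> A"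
    and neg: "\<And>A. A \<in> sets borel \<Longrightarrow> A \<inter> H = {} \<Longrightarrow> \<sigma> A \<le> 0"
    and E: "E \<in> sets borel"
  shows "emeasure (positive_part \<sigma>) E = ennreal (\<sigma> (E \<inter> H))"
proof -
  define m where "m E = (SUP A\<in>{A \<in> sets borel. A \<subseteq> E}. ennreal (\<sigma> A))" for E
  have m: "m E = ennreal (\<sigma> (E \<inter> H))" if E: "E \<in> sets borel" for E
  proof (rule antisym)
    show "m E \<le> ennreal (\<sigma> (E \<inter> H))"
      unfolding m_def
    proof (rule SUP_least)
      fix A assume "A \<in> {A \<in> sets borel. A \<subseteq> E}"
      then have A: "A \<in> sets borel" "A \<subseteq> E" by auto
      have "\<sigma> A = \<sigma> (A \<inter> H) + \<sigma> (A - H)"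
        by (rule vector_measure_split[OF \<sigma> A(1) H])
      moreover have "\<sigma> (A - H) \<le> 0" using A H by (intro neg) auto
      moreover have "\<sigma> (E \<inter> H) = \<sigma> (E \<inter> H \<inter> A) + \<sigma> (E \<inter> H - A)"
        using E H A by (intro vector_measure_split[OF \<sigma>]) auto
      moreover have "0 \<le> \<sigma> (E \<inter> H - A)" using E A H by (intro pos) auto
      moreover have "E \<inter> H \<inter> A = A \<inter> H" using A by auto
      ultimately show "ennreal (\<sigma> A) \<le> ennreal (\<sigma> (E \<inter> H))"
        by (intro ennreal_leI) simp
    qed
    show "ennreal (\<sigma> (E \<inter> H)) \<le> m E"
      unfolding m_def using E H by (intro SUP_upper) auto
  qed
  have "emeasure (positive_part \<sigma>) E = m E"
  proof (rule emeasure_measure_of)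
    show "positive_part \<sigma> = measure_of UNIV (sets borel) m"
      unfolding positive_part_def m_def ..
    show "positive (sets (positive_part \<sigma>)) m"
      by (simp add: positive_def m vector_measure_empty[OF \<sigma>])
    show "countably_additive (sets (positive_part \<sigma>)) m"
    proof (rule countably_additiveI)
      fix A :: "nat \<Rightarrow> 'a set"
      assume A: "range A \<subseteq> sets (positive_part \<sigma>)" "disjoint_family A"
      then have Am: "A i \<in> sets borel" for i by auto
      have "(\<lambda>i. \<sigma> (A i \<inter> H)) sums \<sigma> (\<Union>i. A i \<inter> H)"
        using A Am H by (intro vector_measureD[OF \<sigma>]) (auto simp: disjoint_family_on_def)
      then have s: "(\<lambda>i. \<sigma> (A i \<inter> H)) sums \<sigma> ((\<Union>i. A i) \<inter> H)" by simp
      have "0 \<le> \<sigma> (A i \<inter> H)" for i using Am H by (intro pos) auto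
      then have "(\<Sum>i. ennreal (\<sigma> (A i \<inter> H))) = ennreal (\<sigma> ((\<Union>i. A i) \<inter> H))"
        using s by (simp add: suminf_ennreal2 sums_iff)
      then show "(\<Sum>i. m (A i)) = m (\<Union>i. A i)"
        using Am by (simp add: m)
    qed
  qed (use E in auto)
  with m[OF E] show ?thesis by simp
qed

text \<open>The Hahn set is exported together with the null sets on either side of it, because later
  its sign function has to be approximated. The upper bound for the variation is the triangle
  inequality on each piece of a partition.\<close>

lemma Jordan_decomposition:
  fixes \<sigma> :: "'a::euclidean_space set \<Rightarrow> real"
  assumes \<sigma>: "vector_measure \<sigma>"
  defines "P \<equiv> positive_part \<sigma>" and "Q \<equiv> positive_part (\<lambda>E. - \<sigma> E)"
  obtains H where "H \<in> sets borel" "finite_measure P" "finite_measure Q"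
    "\<And>E. E \<in> sets borel \<Longrightarrow> \<sigma> E = measure P E - measure Q E"
    "emeasure P (- H) = 0" "emeasure Q H = 0"
    "total_variation \<sigma> UNIV = ennreal (measure P UNIV + measure Q UNIV)"
proof -
  obtain H where H: "H \<in> sets borel" "\<And>A. A \<in> sets borel \<Longrightarrow> A \<subseteq> H \<Longrightarrow> 0 \<le> \<sigma> A"
    "\<And>A. A \<in> sets borel \<Longrightarrow> A \<inter> H = {} \<Longrightarrow> \<sigma> A \<le> 0"
    using Hahn_decomposition[OF \<sigma>] by metis
  have P: "emeasure P E = ennreal (\<sigma> (E \<inter> H))" if "E \<in> sets borel" for E
    unfolding P_def by (rule emeasure_positive_part[OF \<sigma> H that])
  have Q: "emeasure Q E = ennreal (- \<sigma> (E - H))" if "E \<in> sets borel" for E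
  proof -
    have "emeasure Q E = ennreal (- \<sigma> (E \<inter> - H))"
      unfolding Q_def
    proof (rule emeasure_positive_part[OF vector_measure_uminus[OF \<sigma>]])
      show "0 \<le> - \<sigma> A" if "A \<in> sets borel" "A \<subseteq> - H" for A
        using H(3)[of A] that by auto
      show "- \<sigma> A \<le> 0" if "A \<in> sets borel" "A \<inter> - H = {}" for A
        using H(2)[of A] that by auto
    qed (use H(1) that in auto)
    then show ?thesis by (simp add: Diff_eq)
  qed
  have "space P = UNIV" "space Q = UNIV" by (simp_all add: P_def Q_def)
  then have fP: "finite_measure P" and fQ: "finite_measure Q"
    by (auto intro!: finite_measureI simp: P Q)
  have mP: "measure P E = \<sigma> (E \<inter> H)" if "E \<in> sets borel" for E
    using P[OF that] H that by (auto simp: measure_def)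
  have mQ: "measure Q E = - \<sigma> (E - H)" if "E \<in> sets borel" for E
  proof -
    have "\<sigma> (E - H) \<le> 0" using H(1) that by (intro H(3)) auto
    then show ?thesis using Q[OF that] by (simp add: measure_def)
  qed
  have eq: "\<sigma> E = measure P E - measure Q E" if "E \<in> sets borel" for E
    using vector_measure_split[OF \<sigma> that H(1)] mP[OF that] mQ[OF that] by simp
  show ?thesis
  proof (rule that[OF H(1) fP fQ eq])
    show "emeasure P (- H) = 0" "emeasure Q H = 0"
      using H(1) vector_measure_empty[OF \<sigma>] by (simp_all add: P Q)
    show "total_variation \<sigma> UNIV = ennreal (measure P UNIV + measure Q UNIV)"
    proof (rule antisym)
      show "total_variation \<sigma> UNIV \<le> ennreal (measure P UNIV + measure Q UNIV)"
        unfolding total_variation_def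
      proof (rule SUP_least, clarify)
        fix A :: "nat \<Rightarrow> 'a set"
        assume A: "range A \<subseteq> sets borel" "disjoint_family A" "(\<Union>i. A i) = UNIV"
        then have Am: "A i \<in> sets borel" for i by auto
        have "ennreal (norm (\<sigma> (A i))) \<le> emeasure P (A i) + emeasure Q (A i)" for i
        proof -
          have "norm (\<sigma> (A i)) \<le> measure P (A i) + measure Q (A i)"
            unfolding eq[OF Am] using measure_nonneg[of P "A i"] measure_nonneg[of Q "A i"]
            unfolding real_norm_def by linarith
          then show ?thesis
            by (simp add: finite_measure.emeasure_eq_measure[OF fP]
                finite_measure.emeasure_eq_measure[OF fQ] ennreal_leI flip: ennreal_plus)
        qed
        then have "(\<Sum>i. ennreal (norm (\<sigma> (A i)))) \<le> (\<Sum>i. emeasure P (A i) + emeasure Q (A i))"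
          by (intro suminf_le) auto
        also have "\<dots> = (\<Sum>i. emeasure P (A i)) + (\<Sum>i. emeasure Q (A i))"
          by (intro suminf_add[symmetric]) auto
        also have "\<dots> = emeasure P (\<Union>i. A i) + emeasure Q (\<Union>i. A i)"
          using A by (simp add: suminf_emeasure P_def Q_def)
        also have "\<dots> = ennreal (measure P UNIV + measure Q UNIV)"
          by (simp add: A finite_measure.emeasure_eq_measure[OF fP]
                finite_measure.emeasure_eq_measure[OF fQ])
        finally show "(\<Sum>i. ennreal (norm (\<sigma> (A i)))) \<le> ennreal (measure P UNIV + measure Q UNIV)" .
      qed
      \<comment> \<open>The partition into \<open>H\<close> and \<open>- H\<close>, padded with
        empty sets, attains the supremum.\<close>
      have "ennreal (measure P UNIV + measure Q UNIV) = ennreal (norm (\<sigma> H)) + ennreal (norm (\<sigma> (- H)))"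
        using mP[of UNIV] mQ[of UNIV] H(2)[of H] H(3)[of "- H"] H(1)
        by (simp add: Compl_eq_Diff_UNIV Diff_Int_distrib2 flip: ennreal_plus)
      also have "\<dots> = (\<Sum>i. ennreal (norm (\<sigma> (binaryset H (- H) i))))"
        by (rule suminf_binaryset_eq[symmetric]) (simp add: vector_measure_empty[OF \<sigma>])
      also have "\<dots> \<le> total_variation \<sigma> UNIV"
        unfolding total_variation_def using H(1)
        by (intro SUP_upper) (auto simp: binaryset_def disjoint_family_on_def split: if_splits)
      finally show "ennreal (measure P UNIV + measure Q UNIV) \<le> total_variation \<sigma> UNIV" .
    qed
  qed
qed

lemma finite_measure_positive_part:
  fixes \<sigma> :: "'a::euclidean_space set \<Rightarrow> real"
  assumes "vector_measure \<sigma>"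
  shows "finite_measure (positive_part \<sigma>)" "finite_measure (positive_part (\<lambda>E. - \<sigma> E))"
  by (rule Jordan_decomposition[OF assms]; assumption)+

lemma total_variation_finite:
  fixes \<sigma> :: "'a::euclidean_space set \<Rightarrow> real"
  assumes "vector_measure \<sigma>"
  shows "total_variation \<sigma> UNIV < \<infinity>"
  by (rule Jordan_decomposition[OF assms]) simp

lemma integrable_positive_part:
  fixes \<sigma> :: "'a::euclidean_space set \<Rightarrow> real"
  assumes "vector_measure \<sigma>" "\<phi> \<in> borel_measurable borel" "\<And>x. \<bar>\<phi> x\<bar> \<le> (B::real)"
  shows "integrable (positive_part \<sigma>) \<phi>" "integrable (positive_part (\<lambda>E. - \<sigma> E)) \<phi>"
  using assms finite_measure_positive_part[OF assms(1)]
  by (auto intro!: finite_measure.integrable_const_bound[where B = B])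

section \<open>Integration against a signed measure\<close>

lemma signed_integral_indicator:
  fixes \<sigma> :: "'a::euclidean_space set \<Rightarrow> real"
  assumes "vector_measure \<sigma>" "E \<in> sets borel"
  shows "signed_integral \<sigma> (indicator E) = \<sigma> E"
  by (rule Jordan_decomposition[OF assms(1)]) (simp add: signed_integral_def assms(2))

lemma signed_integral_add:
  fixes \<sigma> :: "'a::euclidean_space set \<Rightarrow> real"
  assumes "vector_measure \<sigma>"
    and "\<phi> \<in> borel_measurable borel" "\<And>x. \<bar>\<phi> x\<bar> \<le> (B::real)"
    and "\<psi> \<in> borel_measurable borel" "\<And>x. \<bar>\<psi> x\<bar> \<le> (C::real)"
  shows "signed_integral \<sigma> (\<lambda>x. \<phi> x + \<psi> x) = signed_integral \<sigma> \<phi> + signed_integral \<sigma> \<psi>"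
  using integrable_positive_part[OF assms(1-3)] integrable_positive_part[OF assms(1,4,5)]
  by (simp add: signed_integral_def)

lemma signed_integral_cmult: "signed_integral \<sigma> (\<lambda>x. c * \<phi> x) = c * signed_integral \<sigma> \<phi>"
  by (simp add: signed_integral_def right_diff_distrib)

lemma signed_integral_bounded_convergence:
  fixes \<sigma> :: "'a::euclidean_space set \<Rightarrow> real"
  assumes \<sigma>: "vector_measure \<sigma>"
    and "\<phi> \<in> borel_measurable borel" "\<And>n. \<Phi> n \<in> borel_measurable borel"
    and "\<And>n x. \<bar>\<Phi> n x\<bar> \<le> B" "\<And>x. (\<lambda>n. \<Phi> n x) \<longlonglongrightarrow> \<phi> x"
  shows "(\<lambda>n. signed_integral \<sigma> (\<Phi> n)) \<longlonglongrightarrow> signed_integral \<sigma> \<phi>"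
  unfolding signed_integral_def using assms
    finite_measure.integrable_const[OF finite_measure_positive_part(1)[OF \<sigma>]]
    finite_measure.integrable_const[OF finite_measure_positive_part(2)[OF \<sigma>]]
  by (intro tendsto_diff integral_dominated_convergence[where w = "\<lambda>_. B"]) auto

lemma signed_integral_le:
  fixes \<sigma> :: "'a::euclidean_space set \<Rightarrow> real"
  assumes \<sigma>: "vector_measure \<sigma>" and \<phi>: "\<phi> \<in> borel_measurable borel" "\<And>x. \<bar>\<phi> x\<bar> \<le> 1"
  shows "\<bar>signed_integral \<sigma> \<phi>\<bar> \<le> enn2real (total_variation \<sigma> UNIV)"
proof -
  let ?P = "positive_part \<sigma>" and ?Q = "positive_part (\<lambda>E. - \<sigma> E)"
  interpret P: finite_measure ?P by (rule finite_measure_positive_part[OF \<sigma>])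
  interpret Q: finite_measure ?Q by (rule finite_measure_positive_part[OF \<sigma>])
  have "enn2real (total_variation \<sigma> UNIV) = measure ?P UNIV + measure ?Q UNIV"
    by (rule Jordan_decomposition[OF \<sigma>]) (simp add: enn2real_plus)
  moreover have "\<bar>integral\<^sup>L ?P \<phi>\<bar> \<le> (\<integral>x. 1 \<partial>?P)"
    using integrable_positive_part[OF \<sigma> \<phi>] \<phi> by (intro integral_abs_bound[THEN order_trans] integral_mono) auto
  moreover have "\<bar>integral\<^sup>L ?Q \<phi>\<bar> \<le> (\<integral>x. 1 \<partial>?Q)"
    using integrable_positive_part[OF \<sigma> \<phi>] \<phi> by (intro integral_abs_bound[THEN order_trans] integral_mono) auto
  ultimately show ?thesis by (simp add: signed_integral_def)
qed

text \<open>Positive parts are not linear in the measure, since each signed measure has its own Hahn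
  set, so linearity cannot be read off the definition. It holds on indicators, where the integral
  returns the set function itself, and passes from there to all bounded Borel functions. It is
  applied to the coordinate expansion of \<open>\<nu> E \<bullet> y\<close>.\<close>

lemma signed_integral_linear_combination:
  fixes \<tau> :: "'i \<Rightarrow> 'a::euclidean_space set \<Rightarrow> real"
  assumes \<sigma>: "vector_measure \<sigma>" and \<tau>: "\<And>i. i \<in> I \<Longrightarrow> vector_measure (\<tau> i)"
    and eq: "\<And>E. E \<in> sets borel \<Longrightarrow> \<sigma> E = (\<Sum>i\<in>I. c i * \<tau> i E)"
    and \<phi>: "\<phi> \<in> borel_measurable borel" "\<And>x. \<bar>\<phi> x\<bar> \<le> B"
  shows "signed_integral \<sigma> \<phi> = (\<Sum>i\<in>I. c i * signed_integral (\<tau> i) \<phi>)"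
proof -
  \<comment> \<open>The induction rule runs through nonnegative Borel functions without bounds,
    while additivity and convergence need one. Boundedness is therefore a premise inside the
    induction claim.\<close>
  have nonneg: "(\<exists>B. \<forall>x. \<phi> x \<le> B) \<longrightarrow> signed_integral \<sigma> \<phi> = (\<Sum>i\<in>I. c i * signed_integral (\<tau> i) \<phi>)"
    if "\<phi> \<in> borel_measurable borel" "\<And>x. 0 \<le> \<phi> x" for \<phi>
    using that
  proof (induction rule: borel_measurable_induct_real)
    case (set A)
    then show ?case using signed_integral_indicator[OF \<sigma>] signed_integral_indicator[OF \<tau>] eq by simp
  next
    case (mult u k)
    show ?case
    \<comment> \<open>For \<open>k = 0\<close> a bound on \<open>k * u\<close> gives none on
      \<open>u\<close>, so the induction hypothesis cannot be applied; both sides vanish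
      then.\<close>
    proof (cases "k = 0")
      case False
      show ?thesis
      proof
        assume "\<exists>B. \<forall>x. k * u x \<le> B"
        then obtain B where B: "\<And>x. k * u x \<le> B" by blast
        have "u x \<le> B / k" for x
          using B[of x] mult.hyps(1) False by (simp add: field_simps)
        then show "signed_integral \<sigma> (\<lambda>x. k * u x) = (\<Sum>i\<in>I. c i * signed_integral (\<tau> i) (\<lambda>x. k * u x))"
          using mult.IH by (auto simp: signed_integral_cmult sum_distrib_left mult.left_commute)
      qed
    qed (simp add: signed_integral_def)
  next
    case (add u v)
    show ?case
    proof
      assume "\<exists>B. \<forall>x. v x + u x \<le> B"
      then obtain B where B: "\<And>x. v x + u x \<le> B" by blast
      have b: "u x \<le> B" "v x \<le> B" "\<bar>u x\<bar> \<le> B" "\<bar>v x\<bar> \<le> B" for x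
        using B[of x] add.hyps(2)[of x] add.hyps(4)[of x] by auto
      from b(1,2) add.IH have IH: "signed_integral \<sigma> u = (\<Sum>i\<in>I. c i * signed_integral (\<tau> i) u)"
          "signed_integral \<sigma> v = (\<Sum>i\<in>I. c i * signed_integral (\<tau> i) v)"
        by blast+
      show "signed_integral \<sigma> (\<lambda>x. v x + u x) = (\<Sum>i\<in>I. c i * signed_integral (\<tau> i) (\<lambda>x. v x + u x))"
        using IH add.hyps b
        by (subst signed_integral_add[OF \<sigma>, where B = B and C = B])
          (auto simp: signed_integral_add[OF \<tau>, where B = B and C = B] ring_distribs sum.distrib)
    qed
  next
    case (seq U)
    show ?case
    proof
      assume "\<exists>B. \<forall>x. \<phi> x \<le> B"
      then obtain B where B: "\<And>x. \<phi> x \<le> B" by blast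
      have lim: "(\<lambda>i. U i x) \<longlonglongrightarrow> \<phi> x" for x using seq.hyps by simp
      have \<phi>m: "\<phi> \<in> borel_measurable borel"
        using lim seq.hyps(1) by (rule borel_measurable_LIMSEQ_real)
      have "U i x \<le> \<phi> x" for i x
        using seq.hyps lim[of x] by (intro incseq_le) (auto simp: incseq_def le_fun_def)
      then have b: "U i x \<le> B" "\<bar>U i x\<bar> \<le> B" for i x
        using B[of x] seq.hyps(2)[of i x] by (auto intro: order_trans)
      have "(\<lambda>n. signed_integral \<sigma> (U n)) \<longlonglongrightarrow> signed_integral \<sigma> \<phi>"
        using seq.hyps \<phi>m b lim by (intro signed_integral_bounded_convergence[OF \<sigma>]) auto
      moreover have "(\<lambda>n. \<Sum>i\<in>I. c i * signed_integral (\<tau> i) (U n)) \<longlonglongrightarrow>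
          (\<Sum>i\<in>I. c i * signed_integral (\<tau> i) \<phi>)"
        using seq.hyps \<phi>m b lim
        by (intro tendsto_sum tendsto_mult tendsto_const signed_integral_bounded_convergence[OF \<tau>]) auto
      moreover have "signed_integral \<sigma> (U n) = (\<Sum>i\<in>I. c i * signed_integral (\<tau> i) (U n))" for n
        using seq.IH[of n] b by blast
      ultimately show "signed_integral \<sigma> \<phi> = (\<Sum>i\<in>I. c i * signed_integral (\<tau> i) \<phi>)"
        by (simp add: LIMSEQ_unique)
    qed
  qed
  define p where "p x = max (\<phi> x) 0" for x
  define q where "q x = max (- \<phi> x) 0" for x
  have [measurable]: "p \<in> borel_measurable borel" "q \<in> borel_measurable borel"
    using \<phi>(1) unfolding p_def q_def by measurable
  have b: "\<bar>p x\<bar> \<le> B" "\<bar>q x\<bar> \<le> B" for x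
    using \<phi>(2)[of x] by (auto simp: p_def q_def)
  have \<phi>_eq: "\<phi> = (\<lambda>x. p x + (- 1) * q x)" by (auto simp: p_def q_def)
  have split: "signed_integral \<rho> \<phi> = signed_integral \<rho> p - signed_integral \<rho> q" if "vector_measure \<rho>" for \<rho>
    unfolding \<phi>_eq using b
    by (subst signed_integral_add[OF that, where B = B and C = B]) (auto simp: signed_integral_cmult[of _ "-1", simplified])
  have p: "signed_integral \<sigma> p = (\<Sum>i\<in>I. c i * signed_integral (\<tau> i) p)"
    using nonneg[of p] b by (force simp: p_def)
  have q: "signed_integral \<sigma> q = (\<Sum>i\<in>I. c i * signed_integral (\<tau> i) q)"
    using nonneg[of q] b by (force simp: q_def)
  show ?thesis
    using split[OF \<sigma>] p q split[OF \<tau>] by (simp add: right_diff_distrib sum_subtractf)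
qed

text \<open>The sign function of \<open>H\<close> would integrate to the total variation exactly.
  Enlarging \<open>H\<close> to an open \<open>U\<close> flips the sign on a set of small
  \<open>?Q\<close>-measure, which costs twice \<open>measure ?Q U\<close>; hence the bound
  \<open>e / 2\<close>. Smooth functions then converge boundedly to the sign function of
  \<open>U\<close>.\<close>

lemma total_variation_approx:
  fixes \<sigma> :: "'a::euclidean_space set \<Rightarrow> real"
  assumes \<sigma>: "vector_measure \<sigma>" and "e > 0"
  obtains \<phi> :: "'a \<Rightarrow> real" where "\<phi> \<in> Cc_infinity" "\<And>x. \<bar>\<phi> x\<bar> \<le> 1"
    "enn2real (total_variation \<sigma> UNIV) < signed_integral \<sigma> \<phi> + e"
proof -
  let ?P = "positive_part \<sigma>" and ?Q = "positive_part (\<lambda>E. - \<sigma> E)"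
  obtain H where H: "H \<in> sets borel" "finite_measure ?P" "finite_measure ?Q"
    "\<And>E. E \<in> sets borel \<Longrightarrow> \<sigma> E = measure ?P E - measure ?Q E"
    "emeasure ?P (- H) = 0" "emeasure ?Q H = 0"
    "total_variation \<sigma> UNIV = ennreal (measure ?P UNIV + measure ?Q UNIV)"
    by (rule Jordan_decomposition[OF \<sigma>]) blast
  interpret P: finite_measure ?P by fact
  interpret Q: finite_measure ?Q by fact
  have "(INF U\<in>{U. H \<subseteq> U \<and> open U}. emeasure ?Q U) = 0"
    using outer_regular[of ?Q H] H by simp
  then have "(INF U\<in>{U. H \<subseteq> U \<and> open U}. emeasure ?Q U) < ennreal (e / 2)"
    using \<open>e > 0\<close> by simp
  then obtain U where U: "H \<subseteq> U" "open U" "emeasure ?Q U < ennreal (e / 2)"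
    by (auto simp: INF_less_iff)
  have QU: "measure ?Q U < e / 2"
    using U(3) \<open>e > 0\<close> by (simp add: Q.emeasure_eq_measure ennreal_less_iff)
  have Um [measurable]: "U \<in> sets borel" using U(2) by simp
  have PU: "measure ?P U = measure ?P UNIV"
  proof -
    have "emeasure ?P (- U) \<le> emeasure ?P (- H)"
      using U H by (intro emeasure_mono) auto
    then have "measure ?P (- U) = 0" using H(5) by (simp add: measure_def)
    then show ?thesis
      using P.finite_measure_compl[of U] by (simp add: Compl_eq_Diff_UNIV)
  qed
  obtain \<phi> :: "nat \<Rightarrow> 'a \<Rightarrow> real" where \<phi>: "\<And>n. \<phi> n \<in> Cc_infinity" "\<And>n x. \<bar>\<phi> n x\<bar> \<le> 1"
    "\<And>x. (\<lambda>n. \<phi> n x) \<longlonglongrightarrow> 2 * indicator U x - 1"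
    using smooth_approx_sign_open[OF U(2)] by metis
  have "\<phi> n \<in> borel_measurable borel" for n
    using \<phi>(1)[of n] by (auto simp: Cc_infinity_def intro!: borel_measurable_continuous_onI Ck_imp_continuous)
  then have "(\<lambda>n. signed_integral \<sigma> (\<phi> n)) \<longlonglongrightarrow> signed_integral \<sigma> (\<lambda>x. 2 * indicator U x - 1)"
    using \<phi> by (intro signed_integral_bounded_convergence[OF \<sigma>]) auto
  moreover have "signed_integral \<sigma> (\<lambda>x. 2 * indicator U x - 1) > enn2real (total_variation \<sigma> UNIV) - e"
    using QU PU by (simp add: H(7) enn2real_plus signed_integral_def Bochner_Integration.integral_diff integrable_indicator_iff P.emeasure_eq_measure Q.emeasure_eq_measure)
  ultimately have "\<forall>\<^sub>F n in sequentially. signed_integral \<sigma> (\<phi> n) > enn2real (total_variation \<sigma> UNIV) - e"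
    by (rule order_tendstoD)
  then obtain n where "signed_integral \<sigma> (\<phi> n) > enn2real (total_variation \<sigma> UNIV) - e"
    by (auto simp: eventually_sequentially)
  with \<phi> show ?thesis by (intro that[of "\<phi> n"]) auto
qed

section \<open>Translates of functions of bounded variation\<close>

lemma Cc_infinity_measurable:
  assumes "\<phi> \<in> Cc_infinity"
  shows "\<phi> \<in> borel_measurable borel"
  using assms by (auto simp: Cc_infinity_def intro!: borel_measurable_continuous_onI Ck_imp_continuous)

lemma integrable_mult_bounded:
  fixes f \<phi> :: "'a \<Rightarrow> real"
  assumes "integrable M f" "\<phi> \<in> borel_measurable M" "\<And>x. \<bar>\<phi> x\<bar> \<le> B"
  shows "integrable M (\<lambda>x. f x * \<phi> x)"
proof (rule Bochner_Integration.integrable_bound)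
  show "integrable M (\<lambda>x. B * f x)" using assms by simp
  show "AE x in M. norm (f x * \<phi> x) \<le> norm (B * f x)"
    using order_trans[OF assms(3) abs_ge_self] by (intro AE_I2) (simp add: abs_mult mult.commute mult_right_mono)
qed (use assms in measurable)

text \<open>The argument of \<open>total_variation_approx\<close> again, with \<open>H\<close> the
  set where \<open>h\<close> is nonnegative and \<open>Q\<close> the measure whose density is the
  negative part of \<open>h\<close>. The wrong sign on \<open>U - H\<close> costs twice the integral
  of the negative part over \<open>U\<close>.\<close>

lemma L1_norm_approx:
  fixes h :: "'a::euclidean_space \<Rightarrow> real"
  assumes h: "integrable lborel h" and "e > 0"
  obtains \<phi> where "\<phi> \<in> Cc_infinity" "\<And>x. \<bar>\<phi> x\<bar> \<le> 1"
    "(\<integral>x. \<bar>h x\<bar> \<partial>lborel) < (\<integral>x. h x * \<phi> x \<partial>lborel) + e"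
proof -
  have [measurable]: "h \<in> borel_measurable borel" using h by (simp add: integrable_iff_bounded)
  define Q where "Q = density lborel (\<lambda>x. ennreal (max 0 (- h x)))"
  define H where "H = {x. 0 \<le> h x}"
  have [measurable]: "H \<in> sets borel" unfolding H_def by measurable
  have int: "integrable lborel (\<lambda>x. max 0 (- h x) * indicator A x)" if "A \<in> sets borel" for A
    using h that by (intro integrable_mult_bounded[where B = 1]) (auto simp: indicator_def)
  have Q: "emeasure Q A = ennreal (\<integral>x. max 0 (- h x) * indicator A x \<partial>lborel)" if A: "A \<in> sets borel" for A
  proof -
    have "emeasure Q A = (\<integral>\<^sup>+x. ennreal (max 0 (- h x) * indicator A x) \<partial>lborel)"
      unfolding Q_def using A
      by (subst emeasure_density) (auto intro!: nn_integral_cong simp: indicator_def)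
    also have "\<dots> = ennreal (\<integral>x. max 0 (- h x) * indicator A x \<partial>lborel)"
      using int[OF A] by (intro nn_integral_eq_integral) auto
    finally show ?thesis .
  qed
  have "(\<lambda>x. max 0 (- h x) * indicator H x) = (\<lambda>x. 0)" by (rule ext) (auto simp: H_def indicator_def max_def)
  then have "emeasure Q H = 0" by (simp only: Q[OF \<open>H \<in> sets borel\<close>]) simp
  moreover have "sets Q = sets borel" "emeasure Q (space Q) \<noteq> \<infinity>"
    using Q[of UNIV] by (simp_all add: Q_def)
  ultimately have "(INF U\<in>{U. H \<subseteq> U \<and> open U}. emeasure Q U) = 0"
    using outer_regular[of Q H] by simp
  then have "(INF U\<in>{U. H \<subseteq> U \<and> open U}. emeasure Q U) < ennreal (e / 2)"
    using \<open>e > 0\<close> by simp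
  then obtain U where U: "H \<subseteq> U" "open U" "emeasure Q U < ennreal (e / 2)"
    by (auto simp: INF_less_iff)
  have Um [measurable]: "U \<in> sets borel" using U(2) by simp
  have QU: "(\<integral>x. max 0 (- h x) * indicator U x \<partial>lborel) < e / 2"
    using U(3) \<open>e > 0\<close> by (simp add: Q ennreal_less_iff)
  obtain \<phi> :: "nat \<Rightarrow> 'a \<Rightarrow> real" where \<phi>: "\<And>n. \<phi> n \<in> Cc_infinity" "\<And>n x. \<bar>\<phi> n x\<bar> \<le> 1"
    "\<And>x. (\<lambda>n. \<phi> n x) \<longlonglongrightarrow> 2 * indicator U x - 1"
    using smooth_approx_sign_open[OF U(2)] by metis
  have [measurable]: "\<phi> n \<in> borel_measurable borel" for n
    by (rule Cc_infinity_measurable[OF \<phi>(1)])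
  have "(\<lambda>n. \<integral>x. h x * \<phi> n x \<partial>lborel) \<longlonglongrightarrow> (\<integral>x. h x * (2 * indicator U x - 1) \<partial>lborel)"
  proof (rule integral_dominated_convergence[where w = "\<lambda>x. \<bar>h x\<bar>"])
    show "AE x in lborel. norm (h x * \<phi> n x) \<le> \<bar>h x\<bar>" for n
      using \<phi>(2)[of n] by (intro AE_I2) (auto simp: abs_mult intro: mult_left_le)
    show "AE x in lborel. (\<lambda>n. h x * \<phi> n x) \<longlonglongrightarrow> h x * (2 * indicator U x - 1)"
      by (intro AE_I2 tendsto_mult tendsto_const \<phi>(3))
  qed (use h in auto)
  moreover have "(\<integral>x. h x * (2 * indicator U x - 1) \<partial>lborel) > (\<integral>x. \<bar>h x\<bar> \<partial>lborel) - e"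
  proof -
    have "h x * (2 * indicator U x - 1) = \<bar>h x\<bar> - 2 * (max 0 (- h x) * indicator U x)" for x
      using U(1) by (cases "0 \<le> h x"; cases "x \<in> U") (auto simp: H_def)
    then have "(\<integral>x. h x * (2 * indicator U x - 1) \<partial>lborel) =
        (\<integral>x. \<bar>h x\<bar> \<partial>lborel) - 2 * (\<integral>x. max 0 (- h x) * indicator U x \<partial>lborel)"
      using h int[OF Um] by simp
    with QU show ?thesis by simp
  qed
  ultimately have "\<forall>\<^sub>F n in sequentially. (\<integral>x. h x * \<phi> n x \<partial>lborel) > (\<integral>x. \<bar>h x\<bar> \<partial>lborel) - e"
    by (rule order_tendstoD)
  then obtain n where "(\<integral>x. h x * \<phi> n x \<partial>lborel) > (\<integral>x. \<bar>h x\<bar> \<partial>lborel) - e"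
    by (auto simp: eventually_sequentially)
  with \<phi> show ?thesis by (intro that[of "\<phi> n"]) auto
qed

text \<open>The definition tests with vector fields. The field \<open>\<phi> x *\<^sub>R y\<close>
  of constant direction turns the divergence into the derivative of \<open>\<phi>\<close> along
  \<open>y\<close>, and its components recombine into the single signed measure
  \<open>\<nu> E \<bullet> y\<close>.\<close>

lemma distributional_gradient_directional:
  fixes f :: "'a::euclidean_space \<Rightarrow> real" and \<phi> :: "'a \<Rightarrow> real"
  assumes \<nu>: "is_distributional_gradient f \<nu>" and \<phi>: "\<phi> \<in> Cc_infinity" "\<And>x. \<bar>\<phi> x\<bar> \<le> B"
  shows "(\<integral>x. f x * frechet_derivative \<phi> (at x) y \<partial>lborel) = - signed_integral (\<lambda>E. \<nu> E \<bullet> y) \<phi>"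
proof -
  have vm: "vector_measure \<nu>" using \<nu> by (simp add: is_distributional_gradient_def)
  from \<phi>(1) obtain K where K: "\<And>k. Ck k \<phi>" "compact K" "\<And>x. x \<notin> K \<Longrightarrow> \<phi> x = 0"
    by (rule Cc_infinityE) blast
  define v where "v x = \<phi> x *\<^sub>R y" for x
  have "v \<in> Cc_infinity"
    unfolding v_def using K
    by (intro Cc_infinityI[OF _ K(2)] Ck_bounded_linear_comp[OF bounded_linear_scaleR_left]) auto
  then have eq: "(\<integral>x. f x * divergence v x \<partial>lborel) =
      - (\<Sum>b\<in>Basis. signed_integral (\<lambda>E. \<nu> E \<bullet> b) (\<lambda>x. v x \<bullet> b))"
    using \<nu> by (simp add: is_distributional_gradient_def)
  have D: "(\<phi> has_derivative frechet_derivative \<phi> (at x)) (at x)" for x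
    using K(1)[of 1] by (simp add: frechet_derivative_works[symmetric])
  have "divergence v x = frechet_derivative \<phi> (at x) y" for x
  proof -
    have "(v has_derivative (\<lambda>h. frechet_derivative \<phi> (at x) h *\<^sub>R y)) (at x)"
      unfolding v_def by (rule bounded_linear.has_derivative[OF bounded_linear_scaleR_left D])
    then have "frechet_derivative v (at x) = (\<lambda>h. frechet_derivative \<phi> (at x) h *\<^sub>R y)"
      by (metis frechet_derivative_at)
    then have "divergence v x = (\<Sum>b\<in>Basis. (y \<bullet> b) * frechet_derivative \<phi> (at x) b)"
      by (simp add: divergence_def mult.commute)
    also have "\<dots> = frechet_derivative \<phi> (at x) (\<Sum>b\<in>Basis. (y \<bullet> b) *\<^sub>R b)"
      using has_derivative_linear[OF D, of x] by (simp add: linear_sum linear_scale o_def)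
    finally show ?thesis by (simp add: euclidean_representation)
  qed
  moreover have "signed_integral (\<lambda>E. \<nu> E \<bullet> y) \<phi> =
      (\<Sum>b\<in>Basis. (y \<bullet> b) * signed_integral (\<lambda>E. \<nu> E \<bullet> b) \<phi>)"
    by (rule signed_integral_linear_combination[OF vector_measure_inner[OF vm] vector_measure_inner[OF vm] _
          Cc_infinity_measurable[OF \<phi>(1)] \<phi>(2)])
      (simp add: euclidean_inner[of _ y] mult.commute)
  moreover have "(\<lambda>x. v x \<bullet> b) = (\<lambda>x. (y \<bullet> b) * \<phi> x)" for b
    by (auto simp: v_def)
  ultimately show ?thesis using eq by (simp add: signed_integral_cmult)
qed

lemma DERIV_along_line:
  fixes \<phi> :: "'a::real_normed_vector \<Rightarrow> real"
  assumes "\<phi> differentiable at (x - t *\<^sub>R y)"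
  shows "((\<lambda>t. \<phi> (x - t *\<^sub>R y)) has_real_derivative
    - frechet_derivative \<phi> (at (x - t *\<^sub>R y)) y) (at t)"
proof -
  let ?D = "frechet_derivative \<phi> (at (x - t *\<^sub>R y))"
  have D: "(\<phi> has_derivative ?D) (at (x - t *\<^sub>R y))"
    using assms by (simp add: frechet_derivative_works[symmetric])
  have "((\<lambda>t. x - t *\<^sub>R y) has_derivative (\<lambda>h. - (h *\<^sub>R y))) (at t)"
    by (auto intro!: derivative_eq_intros)
  from has_derivative_compose[OF this D]
  have "((\<lambda>t. \<phi> (x - t *\<^sub>R y)) has_derivative (\<lambda>h. ?D (- (h *\<^sub>R y)))) (at t)" .
  moreover have "(\<lambda>h. ?D (- (h *\<^sub>R y))) = (*) (- ?D y)"
    using has_derivative_linear[OF D] by (auto simp: linear_neg linear_scale)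
  ultimately show ?thesis by (simp add: has_field_derivative_def)
qed

text \<open>Uniformity in \<open>x\<close> is the point: it supplies the dominating function
  \<open>L * \<bar>f x\<bar>\<close> for differentiating under the integral. Off \<open>K\<close>
  the derivative vanishes because \<open>\<phi>\<close> is 0 on an open set there.\<close>

lemma Cc_infinity_Lipschitz:
  fixes \<phi> :: "'a::euclidean_space \<Rightarrow> real"
  assumes \<phi>: "\<phi> \<in> Cc_infinity"
  obtains L where "\<And>x s. \<bar>\<phi> (x - s *\<^sub>R y) - \<phi> x\<bar> \<le> L * \<bar>s\<bar>"
proof -
  from \<phi> obtain K where K: "\<And>k. Ck k \<phi>" "compact K" "\<And>x. x \<notin> K \<Longrightarrow> \<phi> x = 0"
    by (rule Cc_infinityE) blast
  have "Ck 0 (\<lambda>x. frechet_derivative \<phi> (at x) y)"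
    using K(1)[of "Suc 0"] unfolding Ck.simps(2)[of 0] by blast
  then have "continuous_on K (\<lambda>x. frechet_derivative \<phi> (at x) y)"
    by (auto intro: continuous_on_subset)
  then have "bounded ((\<lambda>x. frechet_derivative \<phi> (at x) y) ` K)"
    using K(2) by (intro compact_imp_bounded compact_continuous_image)
  then obtain L where L: "L > 0" "\<And>x. x \<in> K \<Longrightarrow> \<bar>frechet_derivative \<phi> (at x) y\<bar> \<le> L"
    by (auto simp: bounded_pos)
  have L': "\<bar>frechet_derivative \<phi> (at x) y\<bar> \<le> L" for x
  proof (cases "x \<in> K")
    case False
    have "((\<lambda>_. 0) has_derivative (\<lambda>_. 0)) (at x)" by simp
    then have "(\<phi> has_derivative (\<lambda>_. 0)) (at x)"
      by (rule has_derivative_transform_within_open[of _ _ _ _ "- K"])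
        (use False K in \<open>auto simp: compact_imp_closed open_Compl\<close>)
    then have "frechet_derivative \<phi> (at x) = (\<lambda>_. 0)"
      by (metis frechet_derivative_at)
    then show ?thesis using L(1) by simp
  qed (use L in auto)
  show ?thesis
  proof (rule that[of L])
    fix x s
    have "((\<lambda>t. \<phi> (x - t *\<^sub>R y)) has_real_derivative - frechet_derivative \<phi> (at (x - t *\<^sub>R y)) y) (at t)" for t
      using K(1)[of 1] by (intro DERIV_along_line) simp
    from field_differentiable_bound[OF convex_UNIV this, of L 0 s]
    show "\<bar>\<phi> (x - s *\<^sub>R y) - \<phi> x\<bar> \<le> L * \<bar>s\<bar>"
      using L' by simp
  qed
qed

text \<open>Dominated convergence along an arbitrary null sequence. The minus sign from
  differentiating \<open>\<phi> (x - t *\<^sub>R y)\<close> cancels the one from the distributional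
  gradient.\<close>

lemma shift_pairing_tendsto:
  fixes f :: "'a::euclidean_space \<Rightarrow> real" and \<phi> :: "'a \<Rightarrow> real"
  assumes f: "integrable lborel f" and \<nu>: "is_distributional_gradient f \<nu>"
    and \<phi>: "\<phi> \<in> Cc_infinity" "\<And>x. \<bar>\<phi> x\<bar> \<le> B"
  shows "((\<lambda>t. ((\<integral>x. f x * \<phi> (x - t *\<^sub>R y) \<partial>lborel) - (\<integral>x. f x * \<phi> x \<partial>lborel)) / t) \<longlongrightarrow>
    signed_integral (\<lambda>E. \<nu> E \<bullet> y) \<phi>) (at 0)"
  unfolding tendsto_at_iff_sequentially
proof (intro allI impI)
  fix X :: "nat \<Rightarrow> real" assume X: "\<forall>i. X i \<in> UNIV - {0}" "X \<longlonglongrightarrow> 0"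
  have [measurable]: "f \<in> borel_measurable borel" using f by (simp add: integrable_iff_bounded)
  have \<phi>m [measurable]: "\<phi> \<in> borel_measurable borel" by (rule Cc_infinity_measurable[OF \<phi>(1)])
  obtain L where L: "\<And>x s. \<bar>\<phi> (x - s *\<^sub>R y) - \<phi> x\<bar> \<le> L * \<bar>s\<bar>"
    using Cc_infinity_Lipschitz[OF \<phi>(1)] by blast
  have C: "Ck (Suc 0) \<phi>" using \<phi>(1) unfolding Cc_infinity_def by blast
  have "Ck 0 (\<lambda>x. frechet_derivative \<phi> (at x) y)"
    using C unfolding Ck.simps(2)[of 0] by blast
  then have Dm [measurable]: "(\<lambda>x. frechet_derivative \<phi> (at x) y) \<in> borel_measurable borel"
    by (auto intro!: borel_measurable_continuous_onI)
  have lim: "(\<lambda>i. (\<phi> (x - X i *\<^sub>R y) - \<phi> x) / X i) \<longlonglongrightarrow> - frechet_derivative \<phi> (at x) y" for x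
  proof -
    have "((\<lambda>t. \<phi> (x - t *\<^sub>R y)) has_real_derivative - frechet_derivative \<phi> (at x) y) (at 0)"
      using DERIV_along_line[of \<phi> x 0 y] C by simp
    then have "((\<lambda>t. (\<phi> (x - t *\<^sub>R y) - \<phi> x) / t) \<longlongrightarrow> - frechet_derivative \<phi> (at x) y) (at 0)"
      by (simp add: DERIV_def)
    then show ?thesis
      unfolding tendsto_at_iff_sequentially using X by (auto simp: o_def)
  qed
  have "(\<lambda>i. \<integral>x. f x * ((\<phi> (x - X i *\<^sub>R y) - \<phi> x) / X i) \<partial>lborel) \<longlonglongrightarrow>
      (\<integral>x. f x * (- frechet_derivative \<phi> (at x) y) \<partial>lborel)"
  proof (rule integral_dominated_convergence[where w = "\<lambda>x. L * \<bar>f x\<bar>"])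
    show "AE x in lborel. norm (f x * ((\<phi> (x - X i *\<^sub>R y) - \<phi> x) / X i)) \<le> L * \<bar>f x\<bar>" for i
    proof (rule AE_I2)
      fix x
      have "\<bar>(\<phi> (x - X i *\<^sub>R y) - \<phi> x) / X i\<bar> \<le> L"
        using L[of x "X i"] X(1) by (simp add: abs_divide divide_le_eq)
      then show "norm (f x * ((\<phi> (x - X i *\<^sub>R y) - \<phi> x) / X i)) \<le> L * \<bar>f x\<bar>"
        unfolding real_norm_def abs_mult by (metis abs_ge_zero mult.commute mult_left_mono)
    qed
    show "AE x in lborel. (\<lambda>i. f x * ((\<phi> (x - X i *\<^sub>R y) - \<phi> x) / X i)) \<longlonglongrightarrow>
        f x * (- frechet_derivative \<phi> (at x) y)"
      by (intro AE_I2 tendsto_mult tendsto_const lim)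
  qed (use f in auto)
  moreover have "(\<integral>x. f x * ((\<phi> (x - X i *\<^sub>R y) - \<phi> x) / X i) \<partial>lborel) =
      ((\<integral>x. f x * \<phi> (x - X i *\<^sub>R y) \<partial>lborel) - (\<integral>x. f x * \<phi> x \<partial>lborel)) / X i" for i
  proof -
    have "integrable lborel (\<lambda>x. f x * \<phi> (x - X i *\<^sub>R y))" "integrable lborel (\<lambda>x. f x * \<phi> x)"
      using \<phi>(2) by (auto intro!: integrable_mult_bounded[OF f])
    then show ?thesis
      by (simp add: Bochner_Integration.integral_diff[symmetric] right_diff_distrib[symmetric])
  qed
  moreover have "(\<integral>x. f x * (- frechet_derivative \<phi> (at x) y) \<partial>lborel) = signed_integral (\<lambda>E. \<nu> E \<bullet> y) \<phi>"
    using distributional_gradient_directional[OF \<nu> \<phi>] by simp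
  ultimately show "((\<lambda>t. ((\<integral>x. f x * \<phi> (x - t *\<^sub>R y) \<partial>lborel) - (\<integral>x. f x * \<phi> x \<partial>lborel)) / t) \<circ> X) \<longlonglongrightarrow>
      signed_integral (\<lambda>E. \<nu> E \<bullet> y) \<phi>"
    by (simp only: o_def)
qed

section \<open>Translation estimates in L1\<close>

lemma integral_lborel_shift:
  fixes g :: "'a::euclidean_space \<Rightarrow> real"
  assumes "g \<in> borel_measurable borel"
  shows "(\<integral>x. g (x + a) \<partial>lborel) = (\<integral>x. g x \<partial>lborel)"
proof -
  have "(\<integral>x. g x \<partial>lborel) = (\<integral>x. g x \<partial>(distr lborel borel ((+) a)))"
    by (simp add: lborel_distr_plus)
  also have "\<dots> = (\<integral>x. g (a + x) \<partial>lborel)"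
    using assms by (subst integral_distr) auto
  finally show ?thesis by (simp add: add.commute)
qed

lemma integrable_lborel_shift:
  fixes g :: "'a::euclidean_space \<Rightarrow> real"
  assumes "integrable lborel g"
  shows "integrable lborel (\<lambda>x. g (x + a))"
proof -
  have "integrable (distr lborel borel ((+) a)) g"
    using assms by (simp add: lborel_distr_plus)
  moreover have "g \<in> borel_measurable borel" using assms by (simp add: integrable_iff_bounded)
  ultimately show ?thesis
    by (subst (asm) integrable_distr_eq) (auto simp: add.commute)
qed

definition shift_L1 :: "('a::euclidean_space \<Rightarrow> real) \<Rightarrow> 'a \<Rightarrow> real" where
  "shift_L1 f y = (\<integral>x. \<bar>f (x + y) - f x\<bar> \<partial>lborel)"

lemma shift_L1_nonneg: "0 \<le> shift_L1 f y"
  by (simp add: shift_L1_def)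

text \<open>The reverse triangle inequality bounds the left side by the distance between the
  translates by \<open>y\<close> and by \<open>z\<close>; translation invariance of Lebesgue measure
  turns this into a single shift by \<open>y - z\<close>.\<close>

lemma shift_L1_diff:
  assumes f: "integrable lborel f"
  shows "\<bar>shift_L1 f y - shift_L1 f z\<bar> \<le> shift_L1 f (y - z)"
proof -
  have [measurable]: "f \<in> borel_measurable borel" using f by (simp add: integrable_iff_bounded)
  note [simp] = f integrable_lborel_shift[OF f]
  have eq: "shift_L1 f (y - z) = (\<integral>x. \<bar>f (x + y) - f (x + z)\<bar> \<partial>lborel)"
    unfolding shift_L1_def
    by (subst integral_lborel_shift[where a = z, symmetric]) (auto simp: algebra_simps)
  have "\<bar>shift_L1 f y - shift_L1 f z\<bar> = \<bar>\<integral>x. \<bar>f (x + y) - f x\<bar> - \<bar>f (x + z) - f x\<bar> \<partial>lborel\<bar>"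
    unfolding shift_L1_def by (subst Bochner_Integration.integral_diff) auto
  also have "\<dots> \<le> (\<integral>x. \<bar>\<bar>f (x + y) - f x\<bar> - \<bar>f (x + z) - f x\<bar>\<bar> \<partial>lborel)"
    by (rule integral_abs_bound)
  also have "\<dots> \<le> (\<integral>x. \<bar>f (x + y) - f (x + z)\<bar> \<partial>lborel)"
    by (rule integral_mono) auto
  finally show ?thesis by (simp add: eq)
qed

lemma shift_pairing_eq:
  fixes f \<phi> :: "'a::euclidean_space \<Rightarrow> real"
  assumes f: "integrable lborel f" and \<phi>: "\<phi> \<in> borel_measurable borel" "\<And>x. \<bar>\<phi> x\<bar> \<le> B"
  shows "(\<integral>x. (f (x + y) - f x) * \<phi> x \<partial>lborel) =
    (\<integral>x. f x * \<phi> (x - y) \<partial>lborel) - (\<integral>x. f x * \<phi> x \<partial>lborel)"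
proof -
  have [measurable]: "f \<in> borel_measurable borel" using f by (simp add: integrable_iff_bounded)
  note [measurable] = \<phi>(1)
  have "(\<integral>x. f x * \<phi> (x - y) \<partial>lborel) = (\<integral>x. f (x + y) * \<phi> x \<partial>lborel)"
    by (subst integral_lborel_shift[where a = y, symmetric]) auto
  moreover have "integrable lborel (\<lambda>x. f (x + y) * \<phi> x)" "integrable lborel (\<lambda>x. f x * \<phi> x)"
    using \<phi> by (auto intro!: integrable_mult_bounded[where B = B] f integrable_lborel_shift[OF f])
  ultimately show ?thesis
    by (simp add: left_diff_distrib)
qed

text \<open>Duality: \<open>t \<mapsto> \<integral> f(x) \<phi>(x - t y) dx\<close> has a derivative bounded by \<open>B\<close>.\<close>

lemma shift_L1_le:
  fixes f :: "'a::euclidean_space \<Rightarrow> real"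
  assumes f: "integrable lborel f" and \<nu>: "is_distributional_gradient f \<nu>" and "t \<ge> 0"
    and B: "\<And>\<phi>. \<phi> \<in> Cc_infinity \<Longrightarrow> (\<And>x. \<bar>\<phi> x\<bar> \<le> 1) \<Longrightarrow> \<bar>signed_integral (\<lambda>E. \<nu> E \<bullet> y) \<phi>\<bar> \<le> B"
  shows "shift_L1 f (t *\<^sub>R y) \<le> t * B"
proof (rule field_le_epsilon)
  fix e :: real assume "e > 0"
  let ?h = "\<lambda>x. f (x + t *\<^sub>R y) - f x"
  have "integrable lborel ?h" using f integrable_lborel_shift[OF f] by auto
  from L1_norm_approx[OF this \<open>e > 0\<close>] obtain \<phi> where \<phi>: "\<phi> \<in> Cc_infinity" "\<And>x. \<bar>\<phi> x\<bar> \<le> 1"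
    and le: "shift_L1 f (t *\<^sub>R y) < (\<integral>x. ?h x * \<phi> x \<partial>lborel) + e"
    unfolding shift_L1_def by blast
  define G where "G s = (\<integral>x. f x * \<phi> (x - s *\<^sub>R y) \<partial>lborel)" for s
  \<comment> \<open>The derivative at \<open>s\<close> is the derivative at 0 for the test function
    translated by \<open>s *\<^sub>R y\<close>, which obeys the same bound 1.\<close>
  have G': "(G has_real_derivative signed_integral (\<lambda>E. \<nu> E \<bullet> y) (\<lambda>x. \<phi> (x - s *\<^sub>R y))) (at s)" for s
    using shift_pairing_tendsto[OF f \<nu> Cc_infinity_shift[OF \<phi>(1), of "s *\<^sub>R y"], of 1 y] \<phi>(2)
    by (simp add: DERIV_def G_def algebra_simps)
  have "\<bar>signed_integral (\<lambda>E. \<nu> E \<bullet> y) (\<lambda>x. \<phi> (x - s *\<^sub>R y))\<bar> \<le> B" for s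
    using \<phi> by (intro B Cc_infinity_shift) auto
  then have "\<bar>G t - G 0\<bar> \<le> B * \<bar>t - 0\<bar>"
    using field_differentiable_bound[OF convex_UNIV G', of B 0 t] by simp
  moreover have "(\<integral>x. ?h x * \<phi> x \<partial>lborel) = G t - G 0"
    using shift_pairing_eq[OF f Cc_infinity_measurable[OF \<phi>(1)] \<phi>(2)] by (simp add: G_def)
  ultimately show "shift_L1 f (t *\<^sub>R y) \<le> t * B + e"
    using le \<open>t \<ge> 0\<close> by (simp add: mult.commute)
qed

text \<open>Kept real so that quotients and Lipschitz estimates can be formed; as the variation is
  finite, \<open>ennreal_dirvar\<close> recovers it. The argument ranges over all vectors, which
  makes the Lipschitz estimate a statement on the whole space.\<close>

definition dirvar :: "('a::euclidean_space set \<Rightarrow> 'a) \<Rightarrow> 'a \<Rightarrow> real" where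
  "dirvar \<nu> \<theta> = enn2real (total_variation (\<lambda>E. \<nu> E \<bullet> \<theta>) UNIV)"

lemma ennreal_dirvar:
  "vector_measure \<nu> \<Longrightarrow> ennreal (dirvar \<nu> \<theta>) = total_variation (\<lambda>E. \<nu> E \<bullet> \<theta>) UNIV"
  unfolding dirvar_def using total_variation_finite[OF vector_measure_inner, of \<nu> \<theta>] by simp

text \<open>The upper estimate holds for every t > 0. For the lower one, a single test function
  almost attaining the variation is fixed: its pairing quotient stays below the L1 quotient and
  converges to a value above \<open>a\<close>.\<close>

lemma shift_L1_quotient_tendsto:
  fixes f :: "'a::euclidean_space \<Rightarrow> real"
  assumes f: "integrable lborel f" and \<nu>: "is_distributional_gradient f \<nu>"
  shows "((\<lambda>t. shift_L1 f (t *\<^sub>R y) / t) \<longlongrightarrow> dirvar \<nu> y) (at_right 0)"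
proof (rule order_tendstoI)
  have vm: "vector_measure (\<lambda>E. \<nu> E \<bullet> y)"
    using \<nu> by (intro vector_measure_inner) (simp add: is_distributional_gradient_def)
  {
    fix a assume a: "dirvar \<nu> y < a"
    have "shift_L1 f (t *\<^sub>R y) / t < a" if "t > 0" for t
    proof -
      have "shift_L1 f (t *\<^sub>R y) \<le> t * dirvar \<nu> y"
        unfolding dirvar_def using that signed_integral_le[OF vm Cc_infinity_measurable]
        by (intro shift_L1_le[OF f \<nu>]) auto
      then have "shift_L1 f (t *\<^sub>R y) / t \<le> dirvar \<nu> y"
        using that by (simp add: divide_le_eq mult.commute)
      with a show ?thesis by simp
    qed
    then show "\<forall>\<^sub>F t in at_right 0. shift_L1 f (t *\<^sub>R y) / t < a"
      by (auto simp: eventually_at_filter)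
  next
    fix a assume a: "a < dirvar \<nu> y"
    then obtain \<phi> :: "'a \<Rightarrow> real" where \<phi>: "\<phi> \<in> Cc_infinity" "\<And>x. \<bar>\<phi> x\<bar> \<le> 1"
      "dirvar \<nu> y < signed_integral (\<lambda>E. \<nu> E \<bullet> y) \<phi> + (dirvar \<nu> y - a)"
      using total_variation_approx[OF vm, of "dirvar \<nu> y - a"] unfolding dirvar_def[symmetric] by auto
    have "((\<lambda>t. ((\<integral>x. f x * \<phi> (x - t *\<^sub>R y) \<partial>lborel) - (\<integral>x. f x * \<phi> x \<partial>lborel)) / t) \<longlongrightarrow>
        signed_integral (\<lambda>E. \<nu> E \<bullet> y) \<phi>) (at_right 0)"
      using shift_pairing_tendsto[OF f \<nu> \<phi>(1,2)] by (rule tendsto_within_subset) auto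
    from order_tendstoD(1)[OF this, of a] \<phi>(3)
    have "\<forall>\<^sub>F t in at_right 0. a < ((\<integral>x. f x * \<phi> (x - t *\<^sub>R y) \<partial>lborel) - (\<integral>x. f x * \<phi> x \<partial>lborel)) / t"
      by simp
    moreover have "\<forall>\<^sub>F t::real in at_right 0. t > 0" by (simp add: eventually_at_right_less)
    ultimately show "\<forall>\<^sub>F t in at_right 0. a < shift_L1 f (t *\<^sub>R y) / t"
    proof eventually_elim
      case (elim t)
      let ?h = "\<lambda>x. f (x + t *\<^sub>R y) - f x"
      have h: "integrable lborel ?h" using f integrable_lborel_shift[OF f] by auto
      have "(\<integral>x. f x * \<phi> (x - t *\<^sub>R y) \<partial>lborel) - (\<integral>x. f x * \<phi> x \<partial>lborel) = (\<integral>x. ?h x * \<phi> x \<partial>lborel)"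
        using shift_pairing_eq[OF f Cc_infinity_measurable[OF \<phi>(1)] \<phi>(2)] by simp
      also have "\<dots> \<le> shift_L1 f (t *\<^sub>R y)"
        unfolding shift_L1_def
      proof (rule integral_mono)
        show "integrable lborel (\<lambda>x. ?h x * \<phi> x)"
          using Cc_infinity_measurable[OF \<phi>(1)] \<phi>(2) by (intro integrable_mult_bounded[OF h, where B = 1]) auto
        show "?h x * \<phi> x \<le> \<bar>?h x\<bar>" for x
          using mult_left_le[OF \<phi>(2)[of x] abs_ge_zero[of "?h x"]] abs_ge_self[of "?h x * \<phi> x"]
          by (simp add: abs_mult)
      qed (use h in auto)
      finally show ?case
        using elim by (simp add: less_divide_eq divide_le_eq)
    qed
  }
qed

text \<open>Expanding \<open>y\<close> in the basis gives a constant that serves all directions at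
  once, namely the sum of the coordinate variations.\<close>

lemma signed_integral_inner_bound:
  fixes \<nu> :: "'a::euclidean_space set \<Rightarrow> 'a"
  assumes vm: "vector_measure \<nu>"
  obtains C where "C \<ge> 0" "\<And>y \<phi>. \<phi> \<in> borel_measurable borel \<Longrightarrow> (\<And>x. \<bar>\<phi> x\<bar> \<le> 1) \<Longrightarrow>
      \<bar>signed_integral (\<lambda>E. \<nu> E \<bullet> y) \<phi>\<bar> \<le> C * norm y"
proof (rule that[of "\<Sum>b\<in>Basis. dirvar \<nu> b"])
  show "0 \<le> (\<Sum>b\<in>Basis. dirvar \<nu> b)" by (auto intro!: sum_nonneg simp: dirvar_def)
  fix y and \<phi> :: "'a \<Rightarrow> real" assume \<phi>: "\<phi> \<in> borel_measurable borel" "\<And>x. \<bar>\<phi> x\<bar> \<le> 1"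
  have "signed_integral (\<lambda>E. \<nu> E \<bullet> y) \<phi> = (\<Sum>b\<in>Basis. (y \<bullet> b) * signed_integral (\<lambda>E. \<nu> E \<bullet> b) \<phi>)"
    by (rule signed_integral_linear_combination[OF vector_measure_inner[OF vm] vector_measure_inner[OF vm] _ \<phi>])
      (simp add: euclidean_inner[of _ y] mult.commute)
  also have "\<bar>\<dots>\<bar> \<le> (\<Sum>b\<in>Basis. norm y * dirvar \<nu> b)"
    unfolding dirvar_def
    by (intro sum_abs[THEN order_trans] sum_mono)
      (auto simp: abs_mult intro!: mult_mono Basis_le_norm signed_integral_le[OF vector_measure_inner[OF vm] \<phi>])
  finally show "\<bar>signed_integral (\<lambda>E. \<nu> E \<bullet> y) \<phi>\<bar> \<le> (\<Sum>b\<in>Basis. dirvar \<nu> b) * norm y"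
    by (simp add: sum_distrib_left mult.commute)
qed

text \<open>Pointwise convergence of equi-Lipschitz functions on a compact set is uniform. This is
  run by contradiction: bad points shrinking to the origin have directions with a convergent
  subsequence, whose limit violates \<open>shift_L1_quotient_tendsto\<close>.\<close>

lemma shift_L1_uniform:
  fixes f :: "'a::euclidean_space \<Rightarrow> real"
  assumes f: "integrable lborel f" and \<nu>: "is_distributional_gradient f \<nu>"
  obtains C where "C \<ge> 0" "\<And>y. shift_L1 f y \<le> C * norm y" "\<And>y. dirvar \<nu> y \<le> C * norm y"
    "continuous_on UNIV (dirvar \<nu>)"
    "\<And>\<eta>. \<eta> > 0 \<Longrightarrow> \<exists>R>0. \<forall>y. y \<noteq> 0 \<longrightarrow> norm y \<le> R \<longrightarrow> \<bar>shift_L1 f y / norm y - dirvar \<nu> (y /\<^sub>R norm y)\<bar> \<le> \<eta>"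
proof -
  have vm: "vector_measure \<nu>" using \<nu> by (simp add: is_distributional_gradient_def)
  obtain C where C: "C \<ge> 0" "\<And>y \<phi>. \<phi> \<in> borel_measurable borel \<Longrightarrow> (\<And>x. \<bar>\<phi> x\<bar> \<le> 1) \<Longrightarrow>
      \<bar>signed_integral (\<lambda>E. \<nu> E \<bullet> y) \<phi>\<bar> \<le> C * norm y"
    using signed_integral_inner_bound[OF vm] by blast
  have L: "shift_L1 f y \<le> C * norm y" for y
    using shift_L1_le[OF f \<nu>, of 1 y "C * norm y"] C(2) Cc_infinity_measurable by auto
  have lim: "((\<lambda>t. shift_L1 f (t *\<^sub>R y) / t) \<longlongrightarrow> dirvar \<nu> y) (at_right 0)" for y
    by (rule shift_L1_quotient_tendsto[OF f \<nu>])
  have quot: "\<bar>shift_L1 f (t *\<^sub>R y) / t - shift_L1 f (t *\<^sub>R z) / t\<bar> \<le> C * norm (y - z)" if "t > 0" for t y z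
  proof -
    have "\<bar>shift_L1 f (t *\<^sub>R y) - shift_L1 f (t *\<^sub>R z)\<bar> \<le> C * norm (t *\<^sub>R y - t *\<^sub>R z)"
      using shift_L1_diff[OF f] L order_trans by blast
    also have "\<dots> = t * (C * norm (y - z))"
      using that by (simp add: scaleR_diff_right[symmetric])
    finally show ?thesis
      using that by (simp add: diff_divide_distrib[symmetric] abs_divide divide_le_eq mult.commute)
  qed
  have lip: "\<bar>dirvar \<nu> y - dirvar \<nu> z\<bar> \<le> C * norm (y - z)" for y z
  proof (rule tendsto_upperbound)
    show "((\<lambda>t. \<bar>shift_L1 f (t *\<^sub>R y) / t - shift_L1 f (t *\<^sub>R z) / t\<bar>) \<longlongrightarrow> \<bar>dirvar \<nu> y - dirvar \<nu> z\<bar>) (at_right 0)"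
      by (intro tendsto_intros lim)
    show "\<forall>\<^sub>F t in at_right 0. \<bar>shift_L1 f (t *\<^sub>R y) / t - shift_L1 f (t *\<^sub>R z) / t\<bar> \<le> C * norm (y - z)"
      using quot by (auto simp: eventually_at_filter)
  qed simp
  have "dirvar \<nu> 0 = 0"
    using lim[of 0] tendsto_unique[of "at_right (0::real)" "\<lambda>_. 0" "dirvar \<nu> 0" 0] by (simp add: shift_L1_def)
  then have B: "dirvar \<nu> y \<le> C * norm y" for y using lip[of y 0] by simp
  have "C-lipschitz_on UNIV (dirvar \<nu>)"
    using lip C(1) by (intro lipschitz_onI) (auto simp: dist_norm)
  then have cont: "continuous_on UNIV (dirvar \<nu>)" by (rule lipschitz_on_continuous_on)
  show ?thesis
  proof (rule that[OF C(1) L B cont], rule ccontr)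
    fix \<eta> :: real assume "\<eta> > 0"
      and "\<not> (\<exists>R>0. \<forall>y. y \<noteq> 0 \<longrightarrow> norm y \<le> R \<longrightarrow> \<bar>shift_L1 f y / norm y - dirvar \<nu> (y /\<^sub>R norm y)\<bar> \<le> \<eta>)"
    then have *: "\<forall>R>0. \<exists>y. y \<noteq> 0 \<and> norm y \<le> R \<and> \<bar>shift_L1 f y / norm y - dirvar \<nu> (y /\<^sub>R norm y)\<bar> > \<eta>"
      by (force simp: not_le)
    have "\<forall>n::nat. \<exists>y. y \<noteq> 0 \<and> norm y \<le> inverse (real (Suc n)) \<and> \<bar>shift_L1 f y / norm y - dirvar \<nu> (y /\<^sub>R norm y)\<bar> > \<eta>"
      by (rule allI, rule *[rule_format]) simp
    then obtain Y where Y: "\<And>n. Y n \<noteq> 0" "\<And>n. norm (Y n) \<le> inverse (real (Suc n))"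
      "\<And>n. \<bar>shift_L1 f (Y n) / norm (Y n) - dirvar \<nu> (Y n /\<^sub>R norm (Y n))\<bar> > \<eta>"
      by metis
    define \<Theta> where "\<Theta> n = Y n /\<^sub>R norm (Y n)" for n
    have "\<forall>n. \<Theta> n \<in> sphere 0 1" using Y(1) by (simp add: \<Theta>_def)
    then obtain \<theta> r where r: "strict_mono (r :: nat \<Rightarrow> nat)" "(\<Theta> \<circ> r) \<longlonglongrightarrow> \<theta>"
      using compact_sphere[of "0::'a" 1] unfolding compact_def by metis
    define t where "t n = norm (Y (r n))" for n
    have t0: "t n > 0" for n using Y(1) by (simp add: t_def)
    have "(\<lambda>n. norm (Y n)) \<longlonglongrightarrow> 0"
      by (rule tendsto_sandwich[OF _ _ tendsto_const LIMSEQ_inverse_real_of_nat]) (use Y(2) in auto)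
    then have "t \<longlonglongrightarrow> 0"
      using LIMSEQ_subseq_LIMSEQ[OF _ r(1)] unfolding t_def o_def by blast
    then have "filterlim t (at_right 0) sequentially"
      using t0 less_imp_neq[OF t0] by (simp add: filterlim_at)
    then have l1: "(\<lambda>n. shift_L1 f (t n *\<^sub>R \<theta>) / t n) \<longlonglongrightarrow> dirvar \<nu> \<theta>"
      by (rule filterlim_compose[OF lim])
    have "(\<lambda>n. norm (\<Theta> (r n) - \<theta>)) \<longlonglongrightarrow> 0"
      using r(2) by (simp add: o_def LIM_zero_iff tendsto_norm_zero)
    then have l2: "(\<lambda>n. 2 * C * norm (\<Theta> (r n) - \<theta>) + \<bar>shift_L1 f (t n *\<^sub>R \<theta>) / t n - dirvar \<nu> \<theta>\<bar>) \<longlonglongrightarrow> 2 * C * 0 + \<bar>dirvar \<nu> \<theta> - dirvar \<nu> \<theta>\<bar>"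
      by (intro tendsto_intros l1)
    \<comment> \<open>Moving from the direction \<open>\<Theta> (r n)\<close> to its limit costs one
      \<open>C\<close> in the quotient and another in \<open>dirvar \<nu>\<close>.\<close>
    have "\<eta> \<le> 2 * C * norm (\<Theta> (r n) - \<theta>) + \<bar>shift_L1 f (t n *\<^sub>R \<theta>) / t n - dirvar \<nu> \<theta>\<bar>" for n
    proof -
      have "t n *\<^sub>R \<Theta> (r n) = Y (r n)" using Y(1) by (simp add: t_def \<Theta>_def)
      then have "\<eta> < \<bar>shift_L1 f (t n *\<^sub>R \<Theta> (r n)) / t n - dirvar \<nu> (\<Theta> (r n))\<bar>"
        using Y(3)[of "r n"] by (simp add: t_def \<Theta>_def)
      then show ?thesis
        using quot[OF t0, of n "\<Theta> (r n)" \<theta>] lip[of "\<Theta> (r n)" \<theta>] by linarith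
    qed
    then have "\<eta> \<le> 2 * C * 0 + \<bar>dirvar \<nu> \<theta> - dirvar \<nu> \<theta>\<bar>"
      by (intro LIMSEQ_le_const[OF l2]) auto
    with \<open>\<eta> > 0\<close> show False by simp
  qed
qed

section \<open>Weak compactness on the sphere\<close>

text \<open>A cosine variant of Schoenberg's function: continuous, of period 2, equal to 0 on
  [0, 1/3] and to 1 on [2/3, 1], because the cosine is 1/2 at pi/3 and -1/2 at 2 pi/3. It reads off
  the first ternary digit of a point of the Cantor set.\<close>

definition tooth :: "real \<Rightarrow> real" where
  "tooth t = max 0 (min 1 (1 / 2 - cos (pi * t)))"

lemma tooth_bounds: "0 \<le> tooth t" "tooth t \<le> 1"
  by (auto simp: tooth_def)

lemma tooth_plus_even: "tooth (t + 2 * real n) = tooth t"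
proof -
  have "cos (pi * (t + 2 * real n)) = cos (pi * t + real n * (2 * pi))"
    by (simp add: algebra_simps)
  also have "\<dots> = cos (pi * t)"
    using cos.plus_of_nat[of "pi * t" n] by simp
  finally show ?thesis by (simp add: tooth_def)
qed

lemma tooth_eq_0:
  assumes "0 \<le> t" "t \<le> 1 / 3"
  shows "tooth t = 0"
proof -
  have "cos (pi * t) \<ge> cos (pi / 3)"
    using assms mult_left_mono[of t "1/3" pi] by (intro cos_monotone_0_pi_le) auto
  then show ?thesis by (simp add: tooth_def cos_60)
qed

lemma tooth_eq_1:
  assumes "2 / 3 \<le> t" "t \<le> 1"
  shows "tooth t = 1"
proof -
  have "cos (pi * t) \<le> cos (pi * (2 / 3))"
    using assms mult_left_mono[of "2/3" t pi] mult_left_mono[of t 1 pi]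
    by (intro cos_monotone_0_pi_le) auto
  also have "\<dots> = - (1 / 2)"
    using cos_120 by (simp add: field_simps)
  finally show ?thesis by (simp add: tooth_def)
qed

text \<open>For 0-1 sequences these are the points of the Cantor set: the ternary digits are 0 and
  2, so the middle thirds, where \<open>tooth\<close> is not constant, are avoided.\<close>

definition cantor_code :: "(nat \<Rightarrow> real) \<Rightarrow> real" where
  "cantor_code a = (\<Sum>m. 2 * a m / 3 ^ Suc m)"

lemma cantor_series: "(\<lambda>m. 2 / 3 ^ Suc m :: real) sums 1"
proof -
  have "(\<lambda>m. (2 / 3) * (1 / 3) ^ m :: real) sums ((2 / 3) * (1 / (1 - 1 / 3)))"
    by (intro sums_mult geometric_sums) simp
  then show ?thesis by (simp add: power_divide)
qed

lemma cantor_code_summable: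
  assumes "\<And>m. a m \<in> {0, 1::real}"
  shows "summable (\<lambda>m. 2 * a m / 3 ^ Suc m)"
proof (rule summable_comparison_test)
  show "\<exists>N. \<forall>n\<ge>N. norm (2 * a n / 3 ^ Suc n) \<le> 2 / 3 ^ Suc n"
  proof (intro exI allI impI)
    show "norm (2 * a n / 3 ^ Suc n) \<le> 2 / 3 ^ Suc n" for n
      using assms[of n] by auto
  qed
qed (rule sums_summable[OF cantor_series])

lemma cantor_code_bounds:
  assumes "\<And>m. a m \<in> {0, 1::real}"
  shows "0 \<le> cantor_code a" "cantor_code a \<le> 1"
proof -
  have a: "0 \<le> a m" "a m \<le> 1" for m using assms[of m] by auto
  show "0 \<le> cantor_code a"
    unfolding cantor_code_def using a by (intro suminf_nonneg cantor_code_summable assms) auto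
  have "cantor_code a \<le> (\<Sum>m. 2 / 3 ^ Suc m)"
    unfolding cantor_code_def using a
    by (intro suminf_le cantor_code_summable assms sums_summable[OF cantor_series] divide_right_mono) auto
  then show "cantor_code a \<le> 1" using cantor_series by (simp add: sums_iff)
qed

lemma cantor_code_shift:
  assumes "\<And>m. a m \<in> {0, 1::real}"
  shows "3 * cantor_code a = 2 * a 0 + cantor_code (\<lambda>m. a (Suc m))"
proof -
  have "cantor_code a = (\<Sum>m. 2 * a (Suc m) / 3 ^ Suc (Suc m)) + 2 * a 0 / 3"
    unfolding cantor_code_def using suminf_split_head[OF cantor_code_summable[of a, OF assms]] by simp
  also have "(\<Sum>m. 2 * a (Suc m) / 3 ^ Suc (Suc m)) = (\<Sum>m. (1 / 3) * (2 * a (Suc m) / 3 ^ Suc m))"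
    by (simp add: field_simps)
  also have "\<dots> = (1 / 3) * cantor_code (\<lambda>m. a (Suc m))"
    unfolding cantor_code_def using assms
    by (intro suminf_mult cantor_code_summable) auto
  finally show ?thesis by simp
qed

text \<open>Multiplying by 3 moves the leading digit in front of the point as an even integer. It
  remains even under further powers of 3, so the period 2 of \<open>tooth\<close> ignores it, and
  the next digit becomes the leading one.\<close>

lemma tooth_cantor_code:
  assumes "\<And>m. a m \<in> {0, 1::real}"
  shows "tooth (3 ^ m * cantor_code a) = a m"
  using assms
proof (induction m arbitrary: a)
  case 0
  let ?r = "cantor_code (\<lambda>m. a (Suc m))"
  have r: "0 \<le> ?r" "?r \<le> 1" using cantor_code_bounds[of "\<lambda>m. a (Suc m)"] 0 by auto
  have c: "cantor_code a = (2 * a 0 + ?r) / 3" using cantor_code_shift[of a] 0 by simp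
  show ?case
  proof (cases "a 0 = 0")
    case True
    then show ?thesis using r c by (simp add: tooth_eq_0)
  next
    case False
    then have "a 0 = 1" using 0[of 0] by auto
    then show ?thesis using r c by (simp add: tooth_eq_1)
  qed
next
  case (Suc m)
  obtain n :: nat where n: "a 0 = real n" using that[of 0] that[of 1] Suc.prems[of 0] by auto
  have "3 ^ Suc m * cantor_code a = 3 ^ m * (2 * a 0 + cantor_code (\<lambda>m. a (Suc m)))"
    using cantor_code_shift[of a] Suc.prems by simp
  also have "\<dots> = 3 ^ m * cantor_code (\<lambda>m. a (Suc m)) + 2 * real (3 ^ m * n)"
    by (simp add: n algebra_simps)
  finally have "tooth (3 ^ Suc m * cantor_code a) = tooth (3 ^ m * cantor_code (\<lambda>m. a (Suc m)))"
    by (simp only: tooth_plus_even)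
  also have "\<dots> = a (Suc m)" using Suc.prems by (intro Suc.IH)
  finally show ?case .
qed

text \<open>The binary digit as a difference of floors, a form in which Borel measurability is
  immediate.\<close>

definition bit_of :: "nat \<Rightarrow> real \<Rightarrow> real" where
  "bit_of k u = real_of_int (\<lfloor>2 ^ Suc k * u\<rfloor> - 2 * \<lfloor>2 ^ k * u\<rfloor>)"

lemma bit_of_in: "bit_of k u \<in> {0, 1}"
proof -
  let ?x = "2 ^ k * u"
  have "\<lfloor>2 * ?x\<rfloor> - 2 * \<lfloor>?x\<rfloor> \<in> {0, 1}"
  proof -
    have "2 * \<lfloor>?x\<rfloor> \<le> \<lfloor>2 * ?x\<rfloor>"
      unfolding le_floor_iff using of_int_floor_le[of ?x] by simp
    moreover have "\<lfloor>2 * ?x\<rfloor> < 2 * \<lfloor>?x\<rfloor> + 2"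
      unfolding floor_less_iff using floor_correct[of ?x] unfolding of_int_add of_int_mult of_int_numeral by linarith
    ultimately show ?thesis by auto
  qed
  then show ?thesis unfolding bit_of_def by (auto simp: mult.assoc)
qed

text \<open>The digits are the increments of the truncations \<open>F k\<close>, so the series
  telescopes; \<open>u < 1\<close> makes the truncation \<open>F 0\<close> vanish.\<close>

lemma bit_of_sums:
  assumes "0 \<le> u" "u < 1"
  shows "(\<lambda>k. bit_of k u / 2 ^ Suc k) sums u"
proof -
  define F where "F k = real_of_int \<lfloor>2 ^ k * u\<rfloor> / 2 ^ k" for k :: nat
  have "F \<longlonglongrightarrow> u"
  proof (rule tendsto_sandwich)
    show "(\<lambda>k. u - (1 / 2) ^ k) \<longlonglongrightarrow> u"
      by (auto intro!: tendsto_eq_intros LIMSEQ_power_zero)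
    show "\<forall>\<^sub>F k in sequentially. u - (1 / 2) ^ k \<le> F k"
    proof (intro always_eventually allI)
      fix k :: nat
      have "2 ^ k * u - 1 \<le> real_of_int \<lfloor>2 ^ k * u\<rfloor>" by linarith
      then have "(2 ^ k * u - 1) / 2 ^ k \<le> F k" unfolding F_def by (rule divide_right_mono) simp
      then show "u - (1 / 2) ^ k \<le> F k" by (simp add: diff_divide_distrib power_divide)
    qed
    show "\<forall>\<^sub>F k in sequentially. F k \<le> u"
    proof (intro always_eventually allI)
      fix k :: nat
      have "F k \<le> (2 ^ k * u) / 2 ^ k" unfolding F_def by (rule divide_right_mono) auto
      then show "F k \<le> u" by simp
    qed
  qed auto
  then have "(\<lambda>k. F (Suc k) - F k) sums (u - F 0)" by (rule telescope_sums)
  moreover have "F 0 = 0" using assms by (simp add: F_def floor_eq_iff)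
  moreover have "F (Suc k) - F k = bit_of k u / 2 ^ Suc k" for k
    by (simp add: F_def bit_of_def field_simps)
  ultimately show ?thesis by simp
qed

text \<open>A Schoenberg curve \<open>d\<close> covering the unit ball, with a Borel section \<open>e\<close>: the bits of
  all coordinates of \<open>x\<close> are merged into the ternary expansion of \<open>e x\<close>.\<close>

lemma space_filling_curve:
  obtains d :: "real \<Rightarrow> 'a::euclidean_space" and e :: "'a \<Rightarrow> real"
  where "continuous_on UNIV d" "e \<in> borel_measurable borel" "\<And>x. 0 \<le> e x" "\<And>x. e x \<le> 1"
    "\<And>x. norm x \<le> 1 \<Longrightarrow> d (e x) = x"
proof -
  let ?B = "Basis :: 'a set"
  \<comment> \<open>The pairing function interleaves the digits of all coordinates into one
    sequence: digit \<open>k\<close> of coordinate \<open>b\<close> is stored at position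
    \<open>idx k b\<close>.\<close>
  define idx where "idx k b = prod_encode (k, to_nat_on ?B b)" for k b
  define c where "c b t = (\<Sum>k. tooth (3 ^ idx k b * t) / 2 ^ Suc k)" for b t
  \<comment> \<open>For x in the unit ball, the map from the coordinate \<open>x \<bullet> b\<close>
    to \<open>(x \<bullet> b + 2) / 4\<close> lands in [1/4, 3/4], strictly below 1 as
    \<open>bit_of_sums\<close> requires; \<open>4 * c b t - 2\<close> undoes it.\<close>
  define d where "d t = (\<Sum>b\<in>?B. (4 * c b t - 2) *\<^sub>R b)" for t
  define a where "a x m = bit_of (fst (prod_decode m)) ((x \<bullet> from_nat_into ?B (snd (prod_decode m)) + 2) / 4)"
    for x :: 'a and m
  define e where "e x = cantor_code (a x)" for x
  have a01: "a x m \<in> {0, 1}" for x m unfolding a_def by (rule bit_of_in)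
  show ?thesis
  proof (rule that)
    have "continuous_on UNIV (c b)" for b
    proof (rule uniform_limit_theorem)
      show "uniform_limit UNIV (\<lambda>n t. \<Sum>k<n. tooth (3 ^ idx k b * t) / 2 ^ Suc k) (c b) sequentially"
        unfolding c_def
      proof (rule Weierstrass_m_test)
        show "norm (tooth (3 ^ idx k b * t) / 2 ^ Suc k) \<le> (1 / 2) ^ k" for k t
        proof -
          have "tooth (3 ^ idx k b * t) / 2 ^ Suc k \<le> 1 / 2 ^ k"
            using tooth_bounds by (intro frac_le) auto
          then show ?thesis using tooth_bounds(1) by (simp add: power_divide)
        qed
        show "summable (\<lambda>k. (1 / 2 :: real) ^ k)" by (rule summable_geometric) simp
      qed
      show "\<forall>\<^sub>F n in sequentially. continuous_on UNIV (\<lambda>t. \<Sum>k<n. tooth (3 ^ idx k b * t) / 2 ^ Suc k)"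
        unfolding tooth_def by (intro always_eventually allI continuous_intros) auto
    qed simp
    then show "continuous_on UNIV d"
      unfolding d_def by (intro continuous_intros)
    have [measurable]: "(\<lambda>x. a x m) \<in> borel_measurable borel" for m
      unfolding a_def bit_of_def of_int_diff of_int_mult by measurable
    show "e \<in> borel_measurable borel"
      unfolding e_def cantor_code_def by measurable
    show "0 \<le> e x" "e x \<le> 1" for x
      unfolding e_def using cantor_code_bounds[OF a01] by auto
    show "d (e x) = x" if "norm x \<le> 1" for x
    proof -
      have "4 * c b (e x) - 2 = x \<bullet> b" if b: "b \<in> ?B" for b
      proof -
        let ?u = "(x \<bullet> b + 2) / 4"
        have "\<bar>x \<bullet> b\<bar> \<le> 1" using Basis_le_norm[OF b, of x] \<open>norm x \<le> 1\<close> by linarith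
        then have u: "0 \<le> ?u" "?u < 1" by auto
        have "tooth (3 ^ idx k b * e x) = bit_of k ?u" for k
        proof -
          have "tooth (3 ^ idx k b * e x) = a x (idx k b)"
            unfolding e_def by (rule tooth_cantor_code[OF a01])
          also have "\<dots> = bit_of k ?u"
            using b by (simp add: a_def idx_def countable_finite)
          finally show ?thesis .
        qed
        then have "c b (e x) = ?u"
          using bit_of_sums[OF u] by (simp add: c_def sums_iff)
        then show ?thesis by simp
      qed
      then show ?thesis by (simp add: d_def euclidean_representation)
    qed
  qed
qed

section \<open>Weak limits of measures on the sphere\<close>

lemma space_unit_sphere_borel [simp]: "space unit_sphere_borel = sphere 0 1"
  by (simp add: unit_sphere_borel_def space_restrict_space)

lemma unit_sphere_borel_measurable:
  "f \<in> borel_measurable borel \<Longrightarrow> f \<in> borel_measurable unit_sphere_borel"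
  unfolding unit_sphere_borel_def by (rule measurable_restrict_space1)

lemma continuous_on_sphere_extend:
  fixes g :: "'a::euclidean_space \<Rightarrow> real"
  assumes "continuous_on (sphere 0 1) g"
  obtains h B where "continuous_on UNIV h" "\<And>x. x \<in> sphere 0 1 \<Longrightarrow> h x = g x" "\<And>x. \<bar>h x\<bar> \<le> B"
proof -
  have "bounded (g ` sphere 0 1)"
    using assms by (intro compact_imp_bounded compact_continuous_image compact_sphere)
  then obtain B where B: "B > 0" "\<And>x. x \<in> sphere 0 1 \<Longrightarrow> norm (g x) \<le> B"
    unfolding bounded_pos by auto
  have "closedin (top_of_set UNIV) (sphere (0::'a) 1)"
    by (simp add: closed_closedin[symmetric])
  from Tietze[OF assms this _ B(2)] B(1) obtain h where
    "continuous_on UNIV h" "\<And>x. x \<in> sphere 0 1 \<Longrightarrow> h x = g x" "\<And>x. norm (h x) \<le> B"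
    by auto
  then show ?thesis by (intro that[of h B]) auto
qed

text \<open>The section \<open>e\<close> need only be Borel, since it merely transports measures;
  \<open>d\<close> has to be continuous, since test functions are composed with it. The identity
  \<open>d (e x) = x\<close> makes the integrals on the line agree with those on the sphere.\<close>

lemma sphere_weak_compactness:
  fixes M :: "nat \<Rightarrow> 'a::euclidean_space measure"
  assumes prob: "\<And>n. prob_space (M n)" and sets: "\<And>n. sets (M n) = sets unit_sphere_borel"
  obtains r \<mu> where "strict_mono r" "prob_space \<mu>" "sets \<mu> = sets unit_sphere_borel"
    "weak_limit_on_sphere (\<lambda>j. M (r j)) \<mu>"
proof -
  let ?S = "sphere (0::'a) 1"
  obtain d :: "real \<Rightarrow> 'a" and e where d: "continuous_on UNIV d" and e: "e \<in> borel_measurable borel"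
    "\<And>x. 0 \<le> e x" "\<And>x. e x \<le> 1" and de: "\<And>x. norm x \<le> 1 \<Longrightarrow> d (e x) = x"
    using space_filling_curve by metis
  have [measurable]: "d \<in> borel_measurable borel" using d by (rule borel_measurable_continuous_onI)
  have sp: "space (M n) = ?S" for n using sets_eq_imp_space_eq[OF sets] by simp
  have em [measurable]: "e \<in> borel_measurable (M n)" for n
    using unit_sphere_borel_measurable[OF e(1)] by (simp add: measurable_cong_sets[OF sets refl])
  define N where "N n = distr (M n) borel e" for n
  have N: "real_distribution (N n)" for n
  proof -
    interpret prob_space "M n" by (rule prob)
    show ?thesis unfolding N_def by (rule real_distribution_distr) simp
  qed
  have "tight N"
    unfolding tight_def
  proof (intro conjI allI impI N)
    fix \<epsilon> :: real assume "\<epsilon> > 0"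
    \<comment> \<open>Tightness is phrased with intervals open on the left, and \<open>e\<close> may
      take the value 0; hence the endpoint -1.\<close>
    have "measure (N n) {-1<..1} = 1" for n
    proof -
      interpret prob_space "M n" by (rule prob)
      have "e -` {-1<..1} \<inter> space (M n) = space (M n)"
        using e(3) less_le_trans[of "-1" 0, OF _ e(2)] by auto
      then show ?thesis
        unfolding N_def by (simp add: measure_distr prob_space)
    qed
    then show "\<exists>a b. a < b \<and> (\<forall>n. 1 - \<epsilon> < measure (N n) {a<..b})"
      using \<open>\<epsilon> > 0\<close> by (intro exI[of _ "-1"] exI[of _ 1]) simp
  qed
  from tight_imp_convergent_subsubsequence[OF this, of id]
  obtain r \<rho> where r: "strict_mono r" and \<rho>: "real_distribution \<rho>" and conv: "weak_conv_m (\<lambda>n. N (r n)) \<rho>"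
    by (auto simp: strict_mono_id o_def)
  interpret \<rho>: real_distribution \<rho> by (rule \<rho>)
  define K where "K = distr \<rho> borel d"
  interpret K: prob_space K unfolding K_def by (rule \<rho>.prob_space_distr) simp
  have setsK [measurable_cong]: "sets K = sets borel" by (simp add: K_def)
  have lim: "(\<lambda>n. \<integral>x. h x \<partial>(M (r n))) \<longlonglongrightarrow> (\<integral>x. h x \<partial>K)"
    if h: "continuous_on UNIV h" "\<And>x. \<bar>h x\<bar> \<le> B" for h :: "'a \<Rightarrow> real" and B
  proof -
    have hm [measurable]: "h \<in> borel_measurable borel" using h(1) by (rule borel_measurable_continuous_onI)
    have "continuous_on UNIV (\<lambda>t. h (d t))"
      using continuous_on_compose2[OF h(1) d] by simp
    then have "(\<lambda>n. \<integral>t. h (d t) \<partial>(N (r n))) \<longlonglongrightarrow> (\<integral>t. h (d t) \<partial>\<rho>)"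
      using h(2) by (intro weak_conv_imp_integral_bdd_continuous_conv[OF N \<rho> conv])
        (auto simp: continuous_on_eq_continuous_at)
    moreover have "(\<integral>t. h (d t) \<partial>(N (r n))) = (\<integral>x. h x \<partial>(M (r n)))" for n
    proof -
      have "(\<integral>t. h (d t) \<partial>(N (r n))) = (\<integral>x. h (d (e x)) \<partial>(M (r n)))"
        unfolding N_def by (subst integral_distr) auto
      also have "\<dots> = (\<integral>x. h x \<partial>(M (r n)))"
        by (rule Bochner_Integration.integral_cong) (auto simp: sp de)
      finally show ?thesis .
    qed
    moreover have "(\<integral>x. h x \<partial>K) = (\<integral>t. h (d t) \<partial>\<rho>)"
      unfolding K_def by (subst integral_distr) auto
    ultimately show ?thesis by simp
  qed
  have ne: "?S \<noteq> {}" using vector_choose_size[of 1, where 'a = 'a] by force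
  \<comment> \<open>The limit lives on the whole space and might leave the sphere. The distance to
    the sphere, truncated at 1 to be bounded, integrates to 0 against every \<open>M (r n)\<close>,
    hence also against \<open>K\<close>.\<close>
  have AE_S: "AE x in K. x \<in> ?S"
  proof -
    define h where "h x = min 1 (infdist x ?S)" for x
    have hc: "continuous_on UNIV h" unfolding h_def by (intro continuous_intros)
    have hb: "\<bar>h x\<bar> \<le> 1" for x using infdist_nonneg[of x ?S] by (simp add: h_def)
    have [measurable]: "h \<in> borel_measurable borel" using hc by (rule borel_measurable_continuous_onI)
    have "(\<integral>x. h x \<partial>(M (r n))) = (\<integral>x. 0 \<partial>(M (r n)))" for n
      by (rule Bochner_Integration.integral_cong) (auto simp: sp h_def)
    then have "(\<integral>x. h x \<partial>K) = 0"
      using LIMSEQ_unique[OF lim[OF hc hb], of 0] by simp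
    moreover have "integrable K h"
      using hb by (intro K.integrable_const_bound[where B = 1]) auto
    moreover have "0 \<le> h x" for x by (simp add: h_def infdist_nonneg)
    ultimately have "AE x in K. h x = 0"
      by (subst (asm) integral_nonneg_eq_0_iff_AE) auto
    then show ?thesis
    proof eventually_elim
      case (elim x)
      then have "infdist x ?S = 0" by (auto simp: h_def min_def split: if_splits)
      then show "x \<in> ?S" using in_closed_iff_infdist_zero[OF closed_sphere ne] by blast
    qed
  qed
  define \<mu> where "\<mu> = restrict_space K ?S"
  have Sm: "?S \<in> sets K" by (simp add: setsK)
  show ?thesis
  proof (rule that[OF r])
    have "emeasure K ?S = 1" using AE_S Sm by (intro K.emeasure_eq_1_AE)
    then show "prob_space \<mu>"
      unfolding \<mu>_def using Sm by (intro prob_space_restrict_space)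
    show "sets \<mu> = sets unit_sphere_borel"
      unfolding \<mu>_def unit_sphere_borel_def by (rule sets_restrict_space_cong[OF setsK])
    show "weak_limit_on_sphere (\<lambda>j. M (r j)) \<mu>"
      unfolding weak_limit_on_sphere_def
    proof (intro allI impI)
      fix g :: "'a \<Rightarrow> real" assume "continuous_on ?S g"
      then obtain h B where h: "continuous_on UNIV h" "\<And>x. x \<in> ?S \<Longrightarrow> h x = g x" "\<And>x. \<bar>h x\<bar> \<le> B"
        using continuous_on_sphere_extend by metis
      have hm [measurable]: "h \<in> borel_measurable borel" using h(1) by (rule borel_measurable_continuous_onI)
      have "(\<integral>x. g x \<partial>(M (r n))) = (\<integral>x. h x \<partial>(M (r n)))" for n
        by (rule Bochner_Integration.integral_cong) (auto simp: sp h(2))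
      moreover have "(\<integral>x. g x \<partial>\<mu>) = (\<integral>x. h x \<partial>K)"
      proof -
        have "(\<integral>x. g x \<partial>\<mu>) = (\<integral>x. h x \<partial>\<mu>)"
          by (rule Bochner_Integration.integral_cong) (auto simp: \<mu>_def space_restrict_space h(2))
        also have "\<dots> = (\<integral>x. indicator ?S x *\<^sub>R h x \<partial>K)"
          unfolding \<mu>_def using Sm by (subst integral_restrict_space) (auto simp: K_def)
        also have "\<dots> = (\<integral>x. h x \<partial>K)"
        proof (rule integral_cong_AE)
          show "(\<lambda>x. indicator ?S x *\<^sub>R h x) \<in> borel_measurable K"
            by (rule borel_measurable_scaleR[OF borel_measurable_indicator[OF Sm]]) simp
          show "AE x in K. indicator ?S x *\<^sub>R h x = h x"
            using AE_S by eventually_elim simp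
        qed simp
        finally show ?thesis .
      qed
      ultimately show "(\<lambda>j. \<integral>\<theta>. g \<theta> \<partial>(M (r j))) \<longlonglongrightarrow> (\<integral>\<theta>. g \<theta> \<partial>\<mu>)"
        using lim[OF h(1,3)] by simp
    qed
  qed
qed

section \<open>The angular measure as an image measure\<close>

definition direction :: "'a::euclidean_space \<Rightarrow> 'a" where
  "direction y = (if y = 0 then SOME b. b \<in> Basis else y /\<^sub>R norm y)"

lemma direction_in_sphere: "direction y \<in> sphere 0 1"
  by (auto simp: direction_def some_in_eq)

lemma direction_measurable: "direction \<in> borel \<rightarrow>\<^sub>M unit_sphere_borel"
proof -
  have "direction \<in> borel_measurable borel"
    unfolding direction_def by measurable
  then show ?thesis
    unfolding unit_sphere_borel_def
    by (intro measurable_restrict_space2) (use direction_in_sphere in auto)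
qed

text \<open>The cone over \<open>E\<close> is the preimage of \<open>E\<close> under
  \<open>direction\<close> without the origin, which is null. The value of \<open>direction\<close>
  at 0 only keeps the map inside the sphere. As an image measure, the angular measure obeys the
  change of variables formula.\<close>

lemma angular_measure_eq_distr:
  fixes M :: "'a::euclidean_space measure"
  assumes M: "sets M = sets borel" and zero: "emeasure M {0} = 0"
  shows "angular_measure M = distr M unit_sphere_borel direction"
proof -
  have dm: "direction \<in> M \<rightarrow>\<^sub>M unit_sphere_borel"
    using direction_measurable by (simp add: measurable_cong_sets[OF M refl])
  have "emeasure M {r *\<^sub>R e |r e. 0 < r \<and> e \<in> E} = emeasure M (direction -` E \<inter> space M)"
    if E: "E \<in> sets (unit_sphere_borel :: 'a measure)" for E
  proof -
    have sub: "E \<subseteq> sphere 0 1" using sets.sets_into_space[OF E] by simp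
    have eq: "{r *\<^sub>R e |r e. 0 < r \<and> e \<in> E} = (direction -` E \<inter> space M) - {0}"
    proof (intro set_eqI iffI)
      fix y assume "y \<in> {r *\<^sub>R e |r e. 0 < r \<and> e \<in> E}"
      then obtain r e where re: "y = r *\<^sub>R e" "0 < r" "e \<in> E" by blast
      have "norm e = 1" using re sub by auto
      then have "direction y = e" "y \<noteq> 0" using re by (auto simp: direction_def)
      then show "y \<in> (direction -` E \<inter> space M) - {0}"
        using re sets_eq_imp_space_eq[OF M] by simp
    next
      fix y assume "y \<in> (direction -` E \<inter> space M) - {0}"
      then have "y = norm y *\<^sub>R direction y" "0 < norm y" "direction y \<in> E"
        by (auto simp: direction_def)
      then show "y \<in> {r *\<^sub>R e |r e. 0 < r \<and> e \<in> E}" by blast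
    qed
    have "{0} \<in> null_sets M" using zero M by (simp add: null_sets_def)
    then show ?thesis
      unfolding eq using measurable_sets[OF dm E] by (intro emeasure_Diff_null_set)
  qed
  then have "angular_measure M = measure_of (sphere 0 1) (sets unit_sphere_borel) (emeasure (distr M unit_sphere_borel direction))"
    unfolding angular_measure_def
    by (intro measure_of_eq)
      (use sets.space_closed[of unit_sphere_borel] in
        \<open>auto simp: emeasure_distr[OF dm] sets.sigma_sets_eq[of unit_sphere_borel, simplified]\<close>)
  also have "\<dots> = distr M unit_sphere_borel direction"
    using measure_of_of_measure[of "distr M unit_sphere_borel direction"] by simp
  finally show ?thesis .
qed

section \<open>Convergence of the difference quotients\<close>

lemma difference_quotient_integral:
  fixes f :: "'a::euclidean_space \<Rightarrow> real"
  assumes f: "integrable lborel f" and C: "\<And>y. shift_L1 f y \<le> C * norm y" "C \<ge> 0"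
    and M: "prob_space M" "sets M = sets borel"
  shows "integrable M (\<lambda>y. shift_L1 f y / norm y)"
    and "(\<integral>\<^sup>+x. (\<integral>\<^sup>+y. ennreal (\<bar>f (x + y) - f x\<bar> / norm y) \<partial>M) \<partial>lborel) =
      ennreal (\<integral>y. shift_L1 f y / norm y \<partial>M)"
proof -
  interpret prob_space M by fact
  interpret pair_sigma_finite lborel M
    by (intro pair_sigma_finite.intro sigma_finite_lborel sigma_finite_measure_axioms)
  note M(2) [measurable_cong]
  have [measurable]: "f \<in> borel_measurable borel" using f by (simp add: integrable_iff_bounded)
  have [measurable]: "shift_L1 f \<in> borel_measurable borel"
    unfolding shift_L1_def by measurable
  \<comment> \<open>At \<open>y = 0\<close> the quotient is 0, because division by 0 yields
    0.\<close>
  have b: "\<bar>shift_L1 f y / norm y\<bar> \<le> C" for y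
    using C shift_L1_nonneg[of f y] by (cases "y = 0") (auto simp: abs_divide divide_le_eq)
  show int: "integrable M (\<lambda>y. shift_L1 f y / norm y)"
    using b by (intro integrable_const_bound[where B = C]) auto
  have "(\<integral>\<^sup>+x. (\<integral>\<^sup>+y. ennreal (\<bar>f (x + y) - f x\<bar> / norm y) \<partial>M) \<partial>lborel) =
      (\<integral>\<^sup>+y. (\<integral>\<^sup>+x. ennreal (\<bar>f (x + y) - f x\<bar> / norm y) \<partial>lborel) \<partial>M)"
    by (rule Fubini'[symmetric]) measurable
  also have "\<dots> = (\<integral>\<^sup>+y. ennreal (shift_L1 f y / norm y) \<partial>M)"
  proof (rule nn_integral_cong)
    fix y
    have "integrable lborel (\<lambda>x. \<bar>f (x + y) - f x\<bar> / norm y)"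
      using f integrable_lborel_shift[OF f, of y] by auto
    then show "(\<integral>\<^sup>+x. ennreal (\<bar>f (x + y) - f x\<bar> / norm y) \<partial>lborel) = ennreal (shift_L1 f y / norm y)"
      by (subst nn_integral_eq_integral) (auto simp: shift_L1_def)
  qed
  also have "\<dots> = ennreal (\<integral>y. shift_L1 f y / norm y \<partial>M)"
    using int by (rule nn_integral_eq_integral) (simp add: shift_L1_nonneg)
  finally show "(\<integral>\<^sup>+x. (\<integral>\<^sup>+y. ennreal (\<bar>f (x + y) - f x\<bar> / norm y) \<partial>M) \<partial>lborel) =
      ennreal (\<integral>y. shift_L1 f y / norm y \<partial>M)" .
qed

text \<open>All integrands in \<open>y\<close> and in \<open>\<theta>\<close> are bounded by
  \<open>C\<close>, so the comparison of \<open>I\<close> with \<open>J\<close> can be made with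
  real integrals, where differences make sense; the extended nonnegative integrals of the statement
  return only at the end.\<close>

lemma difference_quotient_converges:
  fixes f :: "'a::euclidean_space \<Rightarrow> real" and \<Lambda> :: "nat \<Rightarrow> 'a measure"
  assumes prob: "\<And>j. prob_space (\<Lambda> j)" and sets: "\<And>j. sets (\<Lambda> j) = sets borel"
    and zero: "\<And>j. emeasure (\<Lambda> j) {0} = 0"
    and conc: "\<And>R. R > 0 \<Longrightarrow> (\<lambda>j. measure (\<Lambda> j) (- cball 0 R)) \<longlonglongrightarrow> 0"
    and \<mu>: "prob_space \<mu>" "sets \<mu> = sets unit_sphere_borel"
    and weak: "weak_limit_on_sphere (\<lambda>j. angular_measure (\<Lambda> j)) \<mu>"
    and f: "integrable lborel f" and \<nu>: "is_distributional_gradient f \<nu>"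
  shows "(\<lambda>j. \<integral>\<^sup>+x. (\<integral>\<^sup>+y. ennreal (\<bar>f (x + y) - f x\<bar> / norm y) \<partial>(\<Lambda> j)) \<partial>lborel)
    \<longlonglongrightarrow> (\<integral>\<^sup>+\<theta>. total_variation (\<lambda>E. \<nu> E \<bullet> \<theta>) UNIV \<partial>\<mu>)"
proof -
  obtain C where C: "C \<ge> 0" and NC: "\<And>y. shift_L1 f y \<le> C * norm y"
    and gC: "\<And>y. dirvar \<nu> y \<le> C * norm y" and gcont: "continuous_on UNIV (dirvar \<nu>)"
    and unif: "\<And>\<eta>. \<eta> > 0 \<Longrightarrow> \<exists>R>0. \<forall>y. y \<noteq> 0 \<longrightarrow> norm y \<le> R \<longrightarrow>
      \<bar>shift_L1 f y / norm y - dirvar \<nu> (y /\<^sub>R norm y)\<bar> \<le> \<eta>"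
    using shift_L1_uniform[OF f \<nu>] by blast
  have vm: "vector_measure \<nu>" using \<nu> by (simp add: is_distributional_gradient_def)
  have g0: "0 \<le> dirvar \<nu> y" for y by (simp add: dirvar_def)
  have gm [measurable]: "dirvar \<nu> \<in> borel_measurable borel"
    using gcont by (rule borel_measurable_continuous_onI)
  have gS: "dirvar \<nu> \<theta> \<le> C" if "\<theta> \<in> sphere 0 1" for \<theta> using gC[of \<theta>] that by simp
  define I where "I j = (\<integral>y. shift_L1 f y / norm y \<partial>(\<Lambda> j))" for j
  define J where "J j = (\<integral>y. dirvar \<nu> (direction y) \<partial>(\<Lambda> j))" for j
  have dm [measurable]: "direction \<in> \<Lambda> j \<rightarrow>\<^sub>M unit_sphere_borel" for j
    using direction_measurable by (simp add: measurable_cong_sets[OF sets refl])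
  have gdm: "(\<lambda>y. dirvar \<nu> (direction y)) \<in> borel_measurable (\<Lambda> j)" for j
    by (rule measurable_compose[OF dm unit_sphere_borel_measurable[OF gm]])
  have "J j = (\<integral>\<theta>. dirvar \<nu> \<theta> \<partial>(angular_measure (\<Lambda> j)))" for j
    unfolding J_def angular_measure_eq_distr[OF sets zero]
    by (rule integral_distr[symmetric, OF dm unit_sphere_borel_measurable[OF gm]])
  then have J: "J \<longlonglongrightarrow> (\<integral>\<theta>. dirvar \<nu> \<theta> \<partial>\<mu>)"
    using weak continuous_on_subset[OF gcont subset_UNIV] unfolding weak_limit_on_sphere_def by presburger
  have "(\<lambda>j. I j - J j) \<longlonglongrightarrow> 0"
  proof (rule tendstoI)
    fix \<epsilon> :: real assume "\<epsilon> > 0"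
    then obtain R where R: "R > 0" "\<And>y. y \<noteq> 0 \<Longrightarrow> norm y \<le> R \<Longrightarrow>
        \<bar>shift_L1 f y / norm y - dirvar \<nu> (y /\<^sub>R norm y)\<bar> \<le> \<epsilon> / 2"
      using unif[of "\<epsilon> / 2"] by auto
    have "(\<lambda>j. C * measure (\<Lambda> j) (- cball 0 R)) \<longlonglongrightarrow> C * 0"
      by (intro tendsto_intros conc R)
    then have "\<forall>\<^sub>F j in sequentially. C * measure (\<Lambda> j) (- cball 0 R) < \<epsilon> / 2"
      using \<open>\<epsilon> > 0\<close> by (intro order_tendstoD(2)[of _ "C * 0"]) auto
    then show "\<forall>\<^sub>F j in sequentially. dist (I j - J j) 0 < \<epsilon>"
    proof eventually_elim
      case (elim j)
      interpret prob_space "\<Lambda> j" by (rule prob)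
      have cb: "- cball 0 R \<in> sets (\<Lambda> j)" by (simp add: sets)
      have i1: "integrable (\<Lambda> j) (\<lambda>y. shift_L1 f y / norm y)"
        by (rule difference_quotient_integral(1)[OF f NC C prob sets])
      have i2: "integrable (\<Lambda> j) (\<lambda>y. dirvar \<nu> (direction y))"
        using g0 gS[OF direction_in_sphere] by (intro integrable_const_bound[where B = C] gdm) auto
      have i3: "integrable (\<Lambda> j) (\<lambda>y. \<epsilon> / 2 + C * indicator (- cball 0 R) y)"
        using cb by (intro Bochner_Integration.integrable_add integrable_mult_right) (auto simp: emeasure_eq_measure)
      have "AE y in \<Lambda> j. y \<noteq> 0"
        using zero[of j] sets[of j] by (intro AE_I[of _ _ "{0}"]) auto
      \<comment> \<open>Inside the ball the uniform estimate applies. Outside, both terms lie in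
        [0, C], so their difference costs only one \<open>C\<close>.\<close>
      then have "AE y in \<Lambda> j. \<bar>shift_L1 f y / norm y - dirvar \<nu> (direction y)\<bar> \<le> \<epsilon> / 2 + C * indicator (- cball 0 R) y"
      proof eventually_elim
        case (elim y)
        show ?case
        proof (cases "norm y \<le> R")
          case True
          then show ?thesis using R(2)[OF elim True] elim by (simp add: direction_def)
        next
          case False
          have "0 \<le> shift_L1 f y / norm y" "shift_L1 f y / norm y \<le> C"
            using NC[of y] elim by (auto simp: shift_L1_nonneg divide_le_eq)
          then have "\<bar>shift_L1 f y / norm y - dirvar \<nu> (direction y)\<bar> \<le> C"
            using g0[of "direction y"] gS[OF direction_in_sphere[of y]] by (simp add: abs_le_iff)
          then show ?thesis using False \<open>\<epsilon> > 0\<close> by simp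
        qed
      qed
      then have "(\<integral>y. \<bar>shift_L1 f y / norm y - dirvar \<nu> (direction y)\<bar> \<partial>(\<Lambda> j)) \<le>
          (\<integral>y. \<epsilon> / 2 + C * indicator (- cball 0 R) y \<partial>(\<Lambda> j))"
        using i1 i2 i3 by (intro integral_mono_AE) auto
      also have "\<dots> = \<epsilon> / 2 + C * prob (- cball 0 R)"
        using cb by (subst Bochner_Integration.integral_add) (auto simp: emeasure_eq_measure prob_space)
      also have "\<dots> < \<epsilon>" using elim by simp
      finally have "(\<integral>y. \<bar>shift_L1 f y / norm y - dirvar \<nu> (direction y)\<bar> \<partial>(\<Lambda> j)) < \<epsilon>" .
      moreover have "\<bar>I j - J j\<bar> \<le> (\<integral>y. \<bar>shift_L1 f y / norm y - dirvar \<nu> (direction y)\<bar> \<partial>(\<Lambda> j))"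
        unfolding I_def J_def using i1 i2
        by (simp add: integral_abs_bound flip: Bochner_Integration.integral_diff)
      ultimately show ?case by (simp add: dist_real_def)
    qed
  qed
  from tendsto_add[OF this J] have "I \<longlonglongrightarrow> (\<integral>\<theta>. dirvar \<nu> \<theta> \<partial>\<mu>)" by simp
  then have "(\<lambda>j. ennreal (I j)) \<longlonglongrightarrow> ennreal (\<integral>\<theta>. dirvar \<nu> \<theta> \<partial>\<mu>)"
    by (rule tendsto_ennrealI)
  moreover have "ennreal (I j) = (\<integral>\<^sup>+x. (\<integral>\<^sup>+y. ennreal (\<bar>f (x + y) - f x\<bar> / norm y) \<partial>(\<Lambda> j)) \<partial>lborel)" for j
    unfolding I_def by (rule difference_quotient_integral(2)[OF f NC C prob sets, symmetric])
  moreover have "ennreal (\<integral>\<theta>. dirvar \<nu> \<theta> \<partial>\<mu>) = (\<integral>\<^sup>+\<theta>. total_variation (\<lambda>E. \<nu> E \<bullet> \<theta>) UNIV \<partial>\<mu>)"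
  proof -
    interpret prob_space \<mu> by fact
    have "dirvar \<nu> \<in> borel_measurable \<mu>"
      using unit_sphere_borel_measurable[OF gm] by (simp add: measurable_cong_sets[OF \<mu>(2) refl])
    moreover have "space \<mu> = sphere 0 1" using sets_eq_imp_space_eq[OF \<mu>(2)] by simp
    ultimately have "integrable \<mu> (dirvar \<nu>)"
      using g0 gS by (intro integrable_const_bound[where B = C]) auto
    then have "(\<integral>\<^sup>+\<theta>. ennreal (dirvar \<nu> \<theta>) \<partial>\<mu>) = ennreal (\<integral>\<theta>. dirvar \<nu> \<theta> \<partial>\<mu>)"
      using g0 by (intro nn_integral_eq_integral) auto
    then show ?thesis by (simp add: ennreal_dirvar[OF vm])
  qed
  ultimately show ?thesis by simp
qed

theorem theorem3p1:
  fixes lam :: "real \<Rightarrow> 'a::euclidean_space measure"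
  assumes "\<And>\<epsilon>. \<epsilon> > 0 \<Longrightarrow> prob_space (lam \<epsilon>)"
    and "\<And>\<epsilon>. \<epsilon> > 0 \<Longrightarrow> sets (lam \<epsilon>) = sets borel"
    and "\<And>\<epsilon>. \<epsilon> > 0 \<Longrightarrow> emeasure (lam \<epsilon>) {0} = 0"
    and "\<And>R::real. R > 0 \<Longrightarrow> ((\<lambda>\<epsilon>. measure (lam \<epsilon>) (- cball 0 R)) \<longlongrightarrow> 0) (at_right 0)"
  shows "\<exists>(eps :: nat \<Rightarrow> real) (\<mu> :: 'a measure).
      (\<forall>j. eps j > 0) \<and> eps \<longlonglongrightarrow> 0 \<and>
      prob_space \<mu> \<and> sets \<mu> = sets unit_sphere_borel \<and>
      weak_limit_on_sphere (\<lambda>j. angular_measure (lam (eps j))) \<mu> \<and>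
      (\<forall>f\<in>BV.
        (\<lambda>j. \<integral>\<^sup>+x. (\<integral>\<^sup>+y. ennreal (\<bar>f (x + y) - f x\<bar> / norm y) \<partial>(lam (eps j))) \<partial>lborel)
          \<longlonglongrightarrow> (\<integral>\<^sup>+\<theta>. total_variation (\<lambda>E. distributional_gradient f E \<bullet> \<theta>) UNIV \<partial>\<mu>))"
proof -
  \<comment> \<open>The hypotheses concern positive parameters only, so the sequence stays positive;
    positivity is also what makes \<open>eps\<close> converge along
    \<open>at_right 0\<close>.\<close>
  define eps0 where "eps0 j = inverse (real (Suc j))" for j
  have eps0: "eps0 j > 0" for j by (simp add: eps0_def)
  have "prob_space (angular_measure (lam (eps0 j)))" for j
    unfolding angular_measure_eq_distr[OF assms(2,3)[OF eps0]]
    by (rule prob_space.prob_space_distr[OF assms(1)[OF eps0]])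
      (simp add: measurable_cong_sets[OF assms(2)[OF eps0] refl] direction_measurable)
  moreover have "sets (angular_measure (lam (eps0 j))) = sets unit_sphere_borel" for j
    unfolding angular_measure_eq_distr[OF assms(2,3)[OF eps0]] by simp
  ultimately obtain r \<mu> where r: "strict_mono r" and \<mu>: "prob_space \<mu>" "sets \<mu> = sets unit_sphere_borel"
    and weak: "weak_limit_on_sphere (\<lambda>j. angular_measure (lam (eps0 (r j)))) \<mu>"
    using sphere_weak_compactness[of "\<lambda>j. angular_measure (lam (eps0 j))"] by metis
  define eps where "eps j = eps0 (r j)" for j
  have pos: "eps j > 0" for j by (simp add: eps_def eps0)
  have "eps0 \<longlonglongrightarrow> 0" unfolding eps0_def by (rule LIMSEQ_inverse_real_of_nat)
  then have lim: "eps \<longlonglongrightarrow> 0"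
    using LIMSEQ_subseq_LIMSEQ[OF _ r] unfolding eps_def o_def by blast
  have "filterlim eps (at_right 0) sequentially"
    using lim pos less_imp_neq[OF pos] by (simp add: filterlim_at)
  then have conc: "(\<lambda>j. measure (lam (eps j)) (- cball 0 R)) \<longlonglongrightarrow> 0" if "R > 0" for R
    by (rule filterlim_compose[OF assms(4)[OF that]])
  have weak': "weak_limit_on_sphere (\<lambda>j. angular_measure (lam (eps j))) \<mu>"
    using weak by (simp add: eps_def)
  have "(\<lambda>j. \<integral>\<^sup>+x. (\<integral>\<^sup>+y. ennreal (\<bar>f (x + y) - f x\<bar> / norm y) \<partial>(lam (eps j))) \<partial>lborel)
      \<longlonglongrightarrow> (\<integral>\<^sup>+\<theta>. total_variation (\<lambda>E. distributional_gradient f E \<bullet> \<theta>) UNIV \<partial>\<mu>)" if f: "f \<in> BV" for f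
  proof (rule difference_quotient_converges[OF assms(1-3)[OF pos] conc \<mu> weak'])
    show "integrable lborel f" using f by (simp add: BV_def)
    show "is_distributional_gradient f (distributional_gradient f)"
      using f unfolding BV_def distributional_gradient_def by (metis (mono_tags, lifting) mem_Collect_eq someI_ex)
  qed
  with pos lim \<mu> weak' show ?thesis by blast
qed

end
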